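(* There are two separable scattered compact Hausdorff spaces $K$ and $L$ with the third derivative empty, a continuous surjection $\theta\colon L\to K$ and a closed subspace $X$ of $C(L)$ such that (i) $C(L)\simeq\theta^\circ[C(K)]\oplus X$; (ii) the spaces $\theta^\circ[C(K)]$ and $X$ are both $1$-complemented in $C(L)$; (iii) the space $X$ is not a $C$-space.
   Context: $C(K)$ denotes the Banach space of real-valued continuous functions on the compact Hausdorff space $K$ with the supremum norm. The map $\theta^\circ\colon C(K)\to C(L)$ is the isometric embedding $\theta^\circ(g)=g\circ\theta$. The symbol $\simeq$ denotes isomorphism (linear homeomorphism) of Banach spaces. A Banach space is a $C$-space if it is isomorphic to $C(S)$ for some compact Hausdorff space $S$. A closed subspace $Y$ of a Banach space $E$ is $1$-complemented if there is a linear projection of norm one from $E$ onto $Y$. A topological space is scattered if each of its nonempty subspaces has an isolated point; the derivative of a space is the set of its non-isolated points, and the third derivative is obtained by iterating this operation three times. *)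

theory Defs
  imports "HOL-Probability.Discrete_Topology"
begin

section \<open>The Banach spaces $C(K)$\<close>

text \<open>
  Every function on a discrete space is continuous, so \<open>'a discrete \<Rightarrow>\<^sub>C real\<close> is the Banach space of
  all bounded functions \<open>'a \<Rightarrow> real\<close> with the supremum norm. For a compact \<open>K :: 'a topology\<close>,
  extension by zero outside \<open>topspace K\<close> is an isometric embedding of the continuous functions
  on \<open>K\<close> into it; \<open>cspace K\<close> is its image, a closed subspace. The norm, linear structure and
  topology are thereby those of the library.
\<close>

definition cspace :: "'a topology \<Rightarrow> ('a discrete \<Rightarrow>\<^sub>C real) set" where
  "cspace K = {f. continuous_map K euclideanreal (\<lambda>x. apply_bcontfun f (discrete x)) \<and>
                  (\<forall>x. x \<notin> topspace K \<longrightarrow> apply_bcontfun f (discrete x) = 0)}"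

text \<open>The map \<open>\<theta>\<degree>(g) = g \<circ> \<theta>\<close>, again extended by zero outside \<open>topspace L\<close>.\<close>

definition comp_op ::
    "'l topology \<Rightarrow> ('l \<Rightarrow> 'k) \<Rightarrow> ('k discrete \<Rightarrow>\<^sub>C real) \<Rightarrow> ('l discrete \<Rightarrow>\<^sub>C real)" where
  "comp_op L \<theta> g = Bcontfun (\<lambda>d. if of_discrete d \<in> topspace L
                                 then apply_bcontfun g (discrete (\<theta> (of_discrete d))) else 0)"

section \<open>Isomorphisms, \<open>C\<close>-spaces and complemented subspaces\<close>

text \<open>
  Here \<open>V\<close> and \<open>W\<close> are meant to be linear subspaces of the ambient types. A linear map on \<open>V\<close> always
  has a linear (possibly unbounded) extension to the ambient type, so using the total notion
  \<open>linear\<close> is no restriction; continuity is required only on \<open>V\<close> and \<open>W\<close>.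
\<close>

definition banach_isomorphic ::
    "'a::real_normed_vector set \<Rightarrow> 'b::real_normed_vector set \<Rightarrow> bool" where
  "banach_isomorphic V W \<longleftrightarrow> (\<exists>f g. linear f \<and> homeomorphism V W f g)"

text \<open>
  HOL cannot quantify over the type carrying \<open>S\<close>. It is fixed to \<open>'a \<Rightarrow> real\<close>, which is large
  enough for every \<open>S\<close> that can occur: if \<open>T\<close> is an isomorphism of \<open>V\<close> onto \<open>C(S)\<close>, then \<open>S\<close> embeds
  into \<open>'a \<Rightarrow> real\<close> via \<open>s \<mapsto> (v \<mapsto> T v s)\<close>. Theorem \<open>is_C_spaceI\<close> below proves that \<open>S\<close> of any type
  may be used.
\<close>

definition is_C_space :: "'a::real_normed_vector set \<Rightarrow> bool" where
  "is_C_space V \<longleftrightarrow> (\<exists>S :: ('a \<Rightarrow> real) topology.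
      compact_space S \<and> Hausdorff_space S \<and> banach_isomorphic V (cspace S))"

text \<open>
  The supremum is the operator norm of \<open>P\<close> restricted to \<open>E\<close> (cf. \<open>onorm\<close>); \<open>bdd_above\<close> says that
  this restriction is bounded.
\<close>

definition one_complemented :: "'a::real_normed_vector set \<Rightarrow> 'a set \<Rightarrow> bool" where
  "one_complemented Y E \<longleftrightarrow> subspace Y \<and> closed Y \<and> Y \<subseteq> E \<and>
     (\<exists>P. linear P \<and> P ` E = Y \<and> (\<forall>x\<in>E. P (P x) = P x) \<and>
          bdd_above ((\<lambda>x. norm (P x) / norm x) ` E) \<and> (SUP x\<in>E. norm (P x) / norm x) = 1)"

section \<open>Scattered spaces and derivatives\<close>

definition scattered_space :: "'a topology \<Rightarrow> bool" where
  "scattered_space X \<longleftrightarrow>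
     (\<forall>A. A \<subseteq> topspace X \<and> A \<noteq> {} \<longrightarrow> (\<exists>x\<in>A. openin (subtopology X A) {x}))"

definition derivative :: "'a topology \<Rightarrow> 'a topology" where
  "derivative X = subtopology X {x \<in> topspace X. \<not> openin X {x}}"

section \<open>Basic facts\<close>

lemma apply_Bcontfun_discrete:
  fixes f :: "'a discrete \<Rightarrow> real"
  assumes "\<And>x. \<bar>f x\<bar> \<le> B"
  shows "apply_bcontfun (Bcontfun f) = f"
proof (rule Bcontfun_inverse)
  have "continuous_on UNIV f"
    by (auto simp: continuous_on_open_vimage open_discrete)
  moreover have "bounded (range f)"
    using assms by (auto simp: bounded_iff)
  ultimately show "f \<in> bcontfun" by (auto simp: bcontfun_def)
qed

lemma comp_op_apply:
  "apply_bcontfun (comp_op L \<theta> g) (discrete x) =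
     (if x \<in> topspace L then apply_bcontfun g (discrete (\<theta> x)) else 0)"
proof -
  have "apply_bcontfun (comp_op L \<theta> g) = (\<lambda>d. if of_discrete d \<in> topspace L
          then apply_bcontfun g (discrete (\<theta> (of_discrete d))) else 0)"
    unfolding comp_op_def
    by (rule apply_Bcontfun_discrete[where B = "norm g"])
      (use norm_bounded[of g] in auto)
  then show ?thesis by (simp add: discrete_inverse)
qed

lemma discrete_bcontfun_eqI:
  "(\<And>x. apply_bcontfun f (discrete x) = apply_bcontfun g (discrete x)) \<Longrightarrow> f = g"
  by (metis bcontfun_eqI of_discrete_inverse)

lemma cspace_cont_map:
  "f \<in> cspace K \<Longrightarrow> continuous_map K euclideanreal (\<lambda>x. apply_bcontfun f (discrete x))"
  by (simp add: cspace_def)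

text \<open>Every continuous function on a compact \<open>K\<close> is represented by an element of \<open>cspace K\<close>.\<close>

lemma cspace_exists:
  assumes "compact_space K" "continuous_map K euclideanreal h"
  obtains f where "f \<in> cspace K" "\<And>x. x \<in> topspace K \<Longrightarrow> apply_bcontfun f (discrete x) = h x"
proof -
  have "compactin euclideanreal (h ` topspace K)"
    using assms image_compactin compact_space_def by blast
  then have "bounded (h ` topspace K)" by (simp add: compact_imp_bounded)
  then obtain B where B: "\<And>x. x \<in> topspace K \<Longrightarrow> \<bar>h x\<bar> \<le> B" "B > 0"
    by (auto simp: bounded_pos)
  define f where "f = Bcontfun (\<lambda>d. if of_discrete d \<in> topspace K then h (of_discrete d) else 0)"
  have "apply_bcontfun f = (\<lambda>d. if of_discrete d \<in> topspace K then h (of_discrete d) else 0)"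
    unfolding f_def by (rule apply_Bcontfun_discrete[where B = B]) (use B in auto)
  then have f: "apply_bcontfun f (discrete x) = (if x \<in> topspace K then h x else 0)" for x
    by (simp add: discrete_inverse)
  have "continuous_map K euclideanreal (\<lambda>x. apply_bcontfun f (discrete x))"
    by (rule continuous_map_eq[OF assms(2)]) (simp add: f)
  then have "f \<in> cspace K" by (simp add: cspace_def f)
  with f show thesis by (intro that[of f]) auto
qed

lemma subspace_cspace: "subspace (cspace K)"
  unfolding cspace_def subspace_def
  by (auto intro!: continuous_map_add continuous_map_real_mult_left)

lemma closed_cspace: "closed (cspace K)"
  unfolding closed_sequential_limits
proof (intro allI impI)
  fix F f assume F: "(\<forall>n. F n \<in> cspace K) \<and> F \<longlonglongrightarrow> f"
  then have unif: "uniform_limit UNIV (\<lambda>n. apply_bcontfun (F n)) (apply_bcontfun f) sequentially"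
    using tendsto_bcontfun_uniform_limit by blast
  have "continuous_map K Met_TC.mtopology (\<lambda>x. apply_bcontfun f (discrete x))"
  proof (rule Met_TC.continuous_map_uniform_limit[where F = sequentially and f = "\<lambda>n x. apply_bcontfun (F n) (discrete x)"])
    show "\<forall>\<^sub>F n in sequentially. continuous_map K Met_TC.mtopology (\<lambda>x. apply_bcontfun (F n) (discrete x))"
      using F by (simp add: cspace_def)
    show "\<forall>\<^sub>F n in sequentially. \<forall>x\<in>topspace K. apply_bcontfun f (discrete x) \<in> UNIV \<and>
        dist (apply_bcontfun (F n) (discrete x)) (apply_bcontfun f (discrete x)) < e" if "e > 0" for e
      using uniform_limitD[OF unif that] by eventually_elim simp
  qed simp
  moreover have "apply_bcontfun f (discrete x) = 0" if "x \<notin> topspace K" for x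
    using tendsto_uniform_limitI[OF unif, of "discrete x"] F that
    by (simp add: cspace_def LIMSEQ_const_iff)
  ultimately show "f \<in> cspace K" by (simp add: cspace_def)
qed

lemma comp_op_in_cspace:
  assumes "continuous_map L K \<theta>" "g \<in> cspace K"
  shows "comp_op L \<theta> g \<in> cspace L"
proof -
  have "continuous_map L euclideanreal ((\<lambda>x. apply_bcontfun g (discrete x)) \<circ> \<theta>)"
    using assms by (intro continuous_map_compose cspace_cont_map)
  then have "continuous_map L euclideanreal (\<lambda>x. apply_bcontfun (comp_op L \<theta> g) (discrete x))"
    by (rule continuous_map_eq) (simp add: comp_op_apply)
  then show ?thesis by (simp add: cspace_def comp_op_apply)
qed

lemma linear_comp_op: "linear (comp_op L \<theta>)"
  by (rule linearI) (auto intro!: discrete_bcontfun_eqI simp: comp_op_apply)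

lemma norm_comp_op_le: "norm (comp_op L \<theta> g) \<le> norm g"
proof (rule norm_bound)
  fix d show "norm (apply_bcontfun (comp_op L \<theta> g) d) \<le> norm g"
    using norm_bounded[of g] by (cases d) (auto simp: comp_op_apply)
qed

lemma norm_comp_op:
  assumes "\<theta> ` topspace L = topspace K" "g \<in> cspace K"
  shows "norm (comp_op L \<theta> g) = norm g"
proof (rule antisym[OF norm_comp_op_le norm_bound])
  fix d show "norm (apply_bcontfun g d) \<le> norm (comp_op L \<theta> g)"
  proof (cases d)
    case (discrete y)
    show ?thesis
    proof (cases "y \<in> topspace K")
      case True
      then obtain x where "x \<in> topspace L" "y = \<theta> x" using assms by auto
      then show ?thesis
        using norm_bounded[of "comp_op L \<theta> g" "discrete x"] discrete by (simp add: comp_op_apply)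
    qed (use assms discrete in \<open>simp add: cspace_def\<close>)
  qed
qed

lemma banach_isomorphic_trans:
  assumes "banach_isomorphic U V" "banach_isomorphic V W"
  shows "banach_isomorphic U W"
  using assms unfolding banach_isomorphic_def
  by (meson homeomorphism_compose linear_compose)

lemma banach_isomorphic_cspace:
  assumes "homeomorphic_maps K L f g"
  shows "banach_isomorphic (cspace K) (cspace L)"
proof -
  have cont: "continuous_map K L f" "continuous_map L K g"
    and inv: "\<And>x. x \<in> topspace K \<Longrightarrow> g (f x) = x" "\<And>y. y \<in> topspace L \<Longrightarrow> f (g y) = y"
    using assms by (auto simp: homeomorphic_maps_def)
  have 1: "comp_op K f (comp_op L g h) = h" if "h \<in> cspace K" for h
    using that cont inv
    by (intro discrete_bcontfun_eqI) (auto simp: comp_op_apply cspace_def continuous_map_def)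
  have 2: "comp_op L g (comp_op K f h) = h" if "h \<in> cspace L" for h
    using that cont inv
    by (intro discrete_bcontfun_eqI) (auto simp: comp_op_apply cspace_def continuous_map_def)
  have bl: "bounded_linear (comp_op M \<theta>)" for M :: "'c topology" and \<theta> :: "'c \<Rightarrow> 'd"
    by (rule bounded_linear_intro[where K = 1])
      (simp_all add: norm_comp_op_le linear_add[OF linear_comp_op] linear_scale[OF linear_comp_op])
  have "homeomorphism (cspace K) (cspace L) (comp_op L g) (comp_op K f)"
    using cont 1 2
    by (intro homeomorphismI)
      (auto intro: comp_op_in_cspace linear_continuous_on bl)
  then show ?thesis
    using linear_comp_op unfolding banach_isomorphic_def by blast
qed

text \<open>The carrier type of \<open>S\<close> in the definition of a \<open>C\<close>-space is immaterial.\<close>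

theorem is_C_spaceI:
  fixes S :: "'s topology" and V :: "'a::real_normed_vector set"
  assumes S: "compact_space S" "Hausdorff_space S" and iso: "banach_isomorphic V (cspace S)"
  shows "is_C_space V"
proof -
  obtain f g where fg: "linear f" "homeomorphism V (cspace S) f g"
    using iso by (auto simp: banach_isomorphic_def)
  define e where "e = (\<lambda>s v. if v \<in> V then apply_bcontfun (f v) (discrete s) else 0)"
  have "inj_on e (topspace S)"
  proof (rule inj_onI, rule ccontr)
    fix s t assume st: "s \<in> topspace S" "t \<in> topspace S" "e s = e t" "s \<noteq> t"
    have "closedin S {s}" "closedin S {t}"
      using S(2) st by (auto simp: closedin_Hausdorff_sing_eq)
    moreover have "normal_space S"
      using S by (simp add: compact_Hausdorff_or_regular_imp_normal_space)
    ultimately obtain h where h: "continuous_map S euclideanreal h" "h s = 0" "h t = 1"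
      using Urysohn_lemma_alt[of S "{s}" "{t}" 0 1] st(4) by (auto simp: disjnt_def)
    obtain F where F: "F \<in> cspace S"
        "\<And>x. x \<in> topspace S \<Longrightarrow> apply_bcontfun F (discrete x) = h x"
      using cspace_exists[OF S(1) h(1)] by blast
    have gF: "g F \<in> V" "f (g F) = F" using fg(2) F(1) by (auto simp: homeomorphism_def)
    have "e s (g F) = 0" "e t (g F) = 1" using gF F(2) st(1,2) h by (simp_all add: e_def)
    then show False using st(3) by simp
  qed
  define r where "r = inv_into (topspace S) e"
  have re: "r (e s) = s" if "s \<in> topspace S" for s
    using \<open>inj_on e (topspace S)\<close> that by (simp add: r_def)
  define S' where "S' = pullback_topology (e ` topspace S) r S"
  have top: "topspace S' = e ` topspace S"
    using re by (auto simp: S'_def topspace_pullback_topology)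
  have "continuous_map S S' e"
    unfolding S'_def
    by (rule continuous_map_pullback')
      (auto intro: continuous_map_eq[OF continuous_map_id] simp: re)
  moreover have "continuous_map S' S r"
    using continuous_map_pullback[OF continuous_map_id, of "e ` topspace S" r S]
    by (simp add: S'_def)
  ultimately have hm: "homeomorphic_maps S S' e r"
    by (auto simp: homeomorphic_maps_def top re)
  then have "S homeomorphic_space S'" by (auto simp: homeomorphic_space_def)
  then have "compact_space S'" "Hausdorff_space S'"
    using S homeomorphic_compact_space homeomorphic_Hausdorff_space by blast+
  moreover have "banach_isomorphic V (cspace S')"
    using banach_isomorphic_trans[OF iso banach_isomorphic_cspace[OF hm]] .
  ultimately show ?thesis by (auto simp: is_C_space_def)
qed

end

theory Submission
  imports Defs "HOL-Complex_Analysis.Great_Picard"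
begin

text \<open>
  Take an almost disjoint family of sets \<open>E u \<subseteq> \<nat>\<close>, \<open>u \<subseteq> \<nat>\<close>, with signs \<open>v u : E u \<rightarrow> {1, -1}\<close>.
  \<open>K\<close> is the one-point compactification of the \<open>\<Psi>\<close>-space of the \<open>E u\<close>. \<open>L\<close> is the one of a
  \<open>\<Psi>\<close>-space on \<open>\<nat> \<times> {+, -}\<close>, where the two sheets over \<open>E u\<close> are interchanged wherever \<open>v u\<close> is \<open>-1\<close>
  and the resulting two sets get a limit point each. Exchanging the sheets is an involution of
  \<open>L\<close> whose even functions are those coming from \<open>K\<close>; \<open>X\<close> consists of the odd ones.

  An odd function is a function on \<open>\<nat>\<close> whose product with each \<open>v u\<close> converges along \<open>E u\<close>, so the
  signs \<open>v u\<close> themselves belong to \<open>X\<close>, while \<open>\<bar>v u\<bar>\<close> does not. If \<open>T\<close> maps \<open>X\<close> isomorphically onto some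
  \<open>C(S)\<close>, then \<open>X\<close> contains the preimage of \<open>\<bar>T (v u)\<bar>\<close>. On a suitable infinite set \<open>T\<close> is a small
  perturbation of a diagonal operator, modulo what the other \<open>v w\<close> contribute. The latter is
  controlled by choosing the signs by transfinite recursion: every matrix that may represent \<open>T\<close>
  is assigned to an index \<open>u\<close>, and \<open>v u\<close> is taken such that no combination of the other \<open>v w\<close>, mapped
  by the matrix, separates a set \<open>{v u = 1}\<close> or \<open>{v u = -1}\<close> from the zeros of \<open>v u\<close>.
\<close>

section \<open>Selection against countably many prohibitions\<close>

text \<open>A set of size \<open>n + 1\<close> arises by adding an element of \<open>B\<close> to
  one of size \<open>n\<close>, so induction bounds each size by the cardinality of
  \<open>B \<times> B\<close>; the sizes form a countable union.\<close>

lemma card_of_finite_subsets_le: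
  includes cardinal_syntax
  assumes "infinite B"
  shows "|{F. finite F \<and> F \<subseteq> B}| \<le>o |B|"
proof -
  have ne: "\<exists>b. b \<in> B" using assms by (metis ex_in_conv finite.emptyI)
  have n: "|{F. finite F \<and> F \<subseteq> B \<and> card F = n}| \<le>o |B|" for n
  proof (induction n)
    case 0
    have "{F. finite F \<and> F \<subseteq> B \<and> card F = 0} = {{}}" by auto
    then show ?case using ne by (simp add: card_of_singl_ordLeq ex_in_conv)
  next
    case (Suc n)
    let ?S = "{F. finite F \<and> F \<subseteq> B \<and> card F = n}"
    have "{F. finite F \<and> F \<subseteq> B \<and> card F = Suc n} \<subseteq> (\<lambda>(b, F). insert b F) ` (B \<times> ?S)"
    proof
      fix F assume "F \<in> {F. finite F \<and> F \<subseteq> B \<and> card F = Suc n}"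
      then obtain b G where "F = insert b G" "b \<notin> G" "card G = n" "finite G" "F \<subseteq> B"
        by (auto simp: card_Suc_eq_finite)
      then show "F \<in> (\<lambda>(b, F). insert b F) ` (B \<times> ?S)" by (intro image_eqI[of _ _ "(b, G)"]) auto
    qed
    then have "|{F. finite F \<and> F \<subseteq> B \<and> card F = Suc n}| \<le>o |B \<times> ?S|"
      using ordLeq_transitive[OF card_of_mono1 card_of_image] by blast
    moreover have "|B \<times> ?S| \<le>o |B|"
      using Suc assms by (intro card_of_Sigma_ordLeq_infinite) (simp_all add: ordLeq_refl card_of_Card_order)
    ultimately show ?case by (rule ordLeq_transitive)
  qed
  have "{F. finite F \<and> F \<subseteq> B} = (\<Union>n. {F. finite F \<and> F \<subseteq> B \<and> card F = n})" by auto
  moreover have "|\<Union>n. {F. finite F \<and> F \<subseteq> B \<and> card F = n}| \<le>o |B|"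
    using n assms infinite_iff_card_of_nat by (intro card_of_UNION_ordLeq_infinite) auto
  ultimately show ?thesis by simp
qed

text \<open>Choose the values by recursion along a well-order all of whose initial segments are smaller than
  \<open>UNIV\<close>: at each stage there are fewer than \<open>|UNIV|\<close> finite sets of earlier indices, each of which
  prohibits countably many values.\<close>

theorem generic_selection:
  includes cardinal_syntax
  fixes bad :: "'i set \<Rightarrow> ('i \<Rightarrow> 'i) \<Rightarrow> bool"
  assumes unc: "uncountable (UNIV :: 'i set)"
    and cong: "\<And>F g h. (\<And>x. x \<in> F \<Longrightarrow> g x = h x) \<Longrightarrow> bad F g \<Longrightarrow> bad F h"
    and empty: "\<And>g. \<not> bad {} g"
    and step: "\<And>F t g. finite F \<Longrightarrow> t \<notin> F \<Longrightarrow> \<not> bad F g \<Longrightarrow>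
      countable {c. bad (insert t F) (g(t := c))}"
  obtains g where "\<And>F. finite F \<Longrightarrow> \<not> bad F g"
proof -
  define r where "r = |UNIV :: 'i set|"
  have r: "Card_order r" "Field r = UNIV" "Well_order r"
    unfolding r_def by (rule card_of_Card_order Field_card_of card_of_Well_order)+
  then have lin: "Linear_order r" and wf: "wf (r - Id)"
    by (auto simp: well_order_on_def)
  have inf: "infinite (UNIV :: 'i set)" using unc countable_finite by blast
  \<comment> \<open>\<open>P f x c\<close> says that the value \<open>c\<close> at \<open>x\<close>
    completes no bad set with finitely many earlier indices.\<close>
  define P where "P = (\<lambda>f x c. \<forall>F. finite F \<and> F \<subseteq> underS r x \<longrightarrow> \<not> bad (insert x F) (f(x := c)))"
  have max: "\<exists>x\<in>F. \<forall>y\<in>F. (y, x) \<in> r" if "finite F" "F \<noteq> {}" for F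
    using that
  proof (induction rule: finite_ne_induct)
    case (singleton x)
    then show ?case using lin r by (auto simp: order_on_defs refl_on_def)
  next
    case (insert x F)
    then obtain z where z: "z \<in> F" "\<forall>y\<in>F. (y, z) \<in> r" by blast
    have "x \<noteq> z" using insert z by blast
    then have "(x, x) \<in> r" "(x, z) \<in> r \<or> (z, x) \<in> r" "trans r"
      using lin r by (auto simp: order_on_defs refl_on_def total_on_def)
    then show ?case using z by (metis insert_iff transD)
  qed
  \<comment> \<open>A nonempty finite set is judged at its largest element, since all its other
    elements lie strictly below that one.\<close>
  have good: "\<not> bad F f" if F: "finite F" "\<And>y. y \<in> F \<Longrightarrow> P f y (f y)" for F f
  proof (cases "F = {}")
    case False
    then obtain x where x: "x \<in> F" "\<forall>y\<in>F. (y, x) \<in> r" using max F by blast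
    then have "F - {x} \<subseteq> underS r x" by (auto simp: underS_def)
    then have "\<not> bad (insert x (F - {x})) (f(x := f x))"
      using F(1) F(2)[OF x(1)] unfolding P_def by blast
    then show ?thesis using x by (simp add: insert_absorb)
  qed (simp add: empty)
  have "\<exists>c. P f x c" if f: "\<And>y. (y, x) \<in> r - Id \<Longrightarrow> P f y (f y)" for f x
  proof -
    let ?U = "underS r x"
    \<comment> \<open>The initial segment may be finite. Joining a countably infinite
      \<open>N\<close> gives an infinite \<open>B\<close>, still smaller than \<open>UNIV\<close>,
      that bounds both the number of finite sets of predecessors and the values each of them
      prohibits.\<close>
    obtain N :: "'i set" where N: "countable N" "infinite N"
      using inf infinite_countable_subset' by blast
    define B where "B = ?U \<union> N"
    have "infinite B" using N by (simp add: B_def)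
    have "|N| <o |UNIV :: 'i set|"
    proof (rule ccontr)
      assume "\<not> ?thesis"
      then have "|UNIV :: 'i set| \<le>o |N|"
        using not_ordLess_iff_ordLeq card_of_Well_order by blast
      then show False using unc N(1)
        by (meson card_of_ordLeq countable_image_inj_on countable_subset)
    qed
    moreover have "|?U| <o |UNIV :: 'i set|"
      using card_of_underS[OF r(1), of x] r by (simp add: r_def)
    ultimately have B: "|B| <o |UNIV :: 'i set|"
      unfolding B_def using card_of_Un_ordLess_infinite inf by blast
    define W where "W = (\<Union>F\<in>{F. finite F \<and> F \<subseteq> ?U}. {c. bad (insert x F) (f(x := c))})"
    have "|{c. bad (insert x F) (f(x := c))}| \<le>o |B|" if "finite F" "F \<subseteq> ?U" for F
    proof -
      have "\<not> bad F f" using that f by (intro good) (auto simp: underS_def)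
      moreover have "x \<notin> F" using that by (auto simp: underS_def)
      ultimately have "countable {c. bad (insert x F) (f(x := c))}" using step that by blast
      then have "|{c. bad (insert x F) (f(x := c))}| \<le>o |UNIV :: nat set|"
        by (meson card_of_ordLeq countableE top_greatest)
      moreover have "|UNIV :: nat set| \<le>o |B|"
        using \<open>infinite B\<close> infinite_iff_card_of_nat by blast
      ultimately show ?thesis by (rule ordLeq_transitive)
    qed
    moreover have "|{F. finite F \<and> F \<subseteq> ?U}| \<le>o |B|"
    proof -
      have "{F. finite F \<and> F \<subseteq> ?U} \<subseteq> {F. finite F \<and> F \<subseteq> B}" by (auto simp: B_def)
      then show ?thesis
        using ordLeq_transitive[OF card_of_mono1 card_of_finite_subsets_le[OF \<open>infinite B\<close>]] by blast
    qed
    ultimately have "|W| \<le>o |B|"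
      unfolding W_def using \<open>infinite B\<close> by (intro card_of_UNION_ordLeq_infinite) auto
    then have "|W| <o |UNIV :: 'i set|" using B by (rule ordLeq_ordLess_trans)
    then have "W \<noteq> UNIV" using ordLess_irreflexive by metis
    then obtain c where "c \<notin> W" by blast
    then show ?thesis by (auto simp: W_def P_def)
  qed
  \<comment> \<open>Well-founded choice also needs that admissibility at \<open>x\<close> depends
    only on the values below \<open>x\<close>.\<close>
  moreover have "P f x c = P g x c" if fg: "\<And>z. (z, x) \<in> r - Id \<Longrightarrow> f z = g z" for f g x c
  proof -
    have "bad (insert x F) (f(x := c)) \<longleftrightarrow> bad (insert x F) (g(x := c))" if "F \<subseteq> underS r x" for F
    proof -
      have *: "(f(x := c)) y = (g(x := c)) y" if "y \<in> insert x F" for y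
        using that \<open>F \<subseteq> underS r x\<close> fg by (auto simp: underS_def)
      show ?thesis by (rule iffI; erule cong[rotated]) (simp_all only: *)
    qed
    then show ?thesis by (auto simp: P_def)
  qed
  ultimately have "\<exists>f. \<forall>x. P f x (f x)" by (intro dependent_wf_choice[OF wf]) blast+
  then obtain f where "\<And>x. P f x (f x)" by blast
  then show thesis using good by (intro that[of f]) blast
qed

section \<open>Almost disjoint sets with signs\<close>

text \<open>The codes of the initial segments of \<open>p\<close>, that is, a branch of the binary tree.\<close>

definition branch :: "nat set \<Rightarrow> nat \<Rightarrow> nat" where
  "branch p n = prod_encode (n, set_encode (p \<inter> {..<n}))"

lemma branch_eq_iff: "branch p m = branch q n \<longleftrightarrow> m = n \<and> p \<inter> {..<n} = q \<inter> {..<n}"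
  by (auto simp: branch_def set_encode_eq)

lemma inj_branch: "inj (branch p)"
  by (auto simp: inj_def branch_eq_iff)

text \<open>A common code has the same level and the same initial segment on both sides, which is
  impossible once the level exceeds a number where \<open>p\<close> and \<open>q\<close>
  differ.\<close>

lemma finite_branch_Int:
  assumes "p \<noteq> q"
  shows "finite (range (branch p) \<inter> range (branch q))"
proof -
  obtain j where j: "(j \<in> p) \<noteq> (j \<in> q)" using assms by blast
  have "range (branch p) \<inter> range (branch q) \<subseteq> branch p ` {..j}"
  proof
    fix x assume "x \<in> range (branch p) \<inter> range (branch q)"
    then obtain n where n: "x = branch p n" "p \<inter> {..<n} = q \<inter> {..<n}"
      by (auto simp: branch_eq_iff)
    then have "n \<le> j" using j by (metis Int_iff lessThan_iff not_le)
    then show "x \<in> branch p ` {..j}" using n by blast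
  qed
  then show ?thesis by (rule finite_subset) simp
qed

text \<open>Transporting branches by \<open>enumerate A\<close> gives continuum many almost disjoint
  candidates inside one prescribed infinite set \<open>A\<close>; alternating by level makes both
  signs occur infinitely often.\<close>

definition signs :: "nat set \<Rightarrow> nat set \<Rightarrow> nat \<Rightarrow> real" where
  "signs A p k = (if k \<in> enumerate A ` branch p ` {n. even n} then 1
                  else if k \<in> enumerate A ` branch p ` {n. odd n} then -1 else 0)"

lemma signs_cases: "signs A p k \<in> {-1, 0, 1}"
  by (auto simp: signs_def)

lemma abs_signs_le: "\<bar>signs A p k\<bar> \<le> 1"
  by (auto simp: signs_def)

lemma signs_nonzero: "signs A p k \<noteq> 0 \<Longrightarrow> k \<in> enumerate A ` range (branch p)"
  by (auto simp: signs_def split: if_splits)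

lemma signs_in:
  assumes "infinite A" "signs A p k \<noteq> 0"
  shows "k \<in> A"
  using signs_nonzero[OF assms(2)] enumerate_in_set[OF assms(1)] by auto

lemma infinite_signs:
  assumes A: "infinite A" and s: "s \<in> {1, -1}"
  shows "infinite {k. signs A p k = s}"
proof -
  define f where "f = enumerate A \<circ> branch p"
  have inj: "inj f"
    unfolding f_def using inj_branch inj_enumerate[OF A] by (rule inj_compose[rotated])
  have ev: "signs A p (f (2 * n)) = 1" for n by (auto simp: signs_def f_def)
  have od: "signs A p (f (2 * n + 1)) = -1" for n
  proof -
    have "f (2 * n + 1) \<noteq> f m" if "even m" for m
      using inj that by (metis injD dvd_triv_left even_add odd_one)
    then show ?thesis by (auto simp: signs_def f_def)
  qed
  have "infinite (range (\<lambda>n. f (2 * n)))" "infinite (range (\<lambda>n. f (2 * n + 1)))"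
    by (rule range_inj_infinite, rule injI, simp add: inj_eq[OF inj])+
  moreover have "range (\<lambda>n. f (2 * n)) \<subseteq> {k. signs A p k = 1}"
      "range (\<lambda>n. f (2 * n + 1)) \<subseteq> {k. signs A p k = -1}"
    using ev od by auto
  ultimately show ?thesis using s by (auto dest: finite_subset)
qed

lemma finite_signs_common:
  assumes "infinite A" "p \<noteq> q"
  shows "finite {k. signs A p k \<noteq> 0 \<and> signs A q k \<noteq> 0}"
proof -
  have "{k. signs A p k \<noteq> 0 \<and> signs A q k \<noteq> 0} \<subseteq>
      enumerate A ` (range (branch p) \<inter> range (branch q))"
    using signs_nonzero[of A p] signs_nonzero[of A q]
    by (subst image_Int[OF inj_enumerate[OF assms(1)]]) auto
  then show ?thesis using finite_branch_Int[OF assms(2)] by (blast intro: finite_subset)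
qed

section \<open>Limits along a set and matrices with bounded rows\<close>

definition along :: "nat set \<Rightarrow> nat filter" where
  "along A = inf sequentially (principal A)"

lemma eventually_along:
  "eventually P (along A) \<longleftrightarrow> (\<exists>N. \<forall>n\<ge>N. n \<in> A \<longrightarrow> P n)"
  by (simp add: along_def eventually_inf_principal eventually_sequentially)

text \<open>Only pairs far out in \<open>A\<close> count, so adding to \<open>f\<close> a function
  that converges along \<open>A\<close> costs an arbitrarily small part of \<open>d\<close>.\<close>

definition separates :: "(nat \<Rightarrow> real) \<Rightarrow> nat set \<Rightarrow> (nat \<Rightarrow> real) \<Rightarrow> real \<Rightarrow> real \<Rightarrow> bool" where
  "separates f A v s d \<longleftrightarrow> (\<exists>N. \<forall>g h. g \<ge> N \<longrightarrow> h \<ge> N \<longrightarrow> g \<in> A \<longrightarrow> h \<in> A \<longrightarrow>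
     v g = s \<longrightarrow> v h = 0 \<longrightarrow> f g - f h \<ge> d)"

definition mat_app :: "(nat \<Rightarrow> nat \<Rightarrow> real) \<Rightarrow> (nat \<Rightarrow> real) \<Rightarrow> nat \<Rightarrow> real" where
  "mat_app M v m = (\<Sum>k. M m k * v k)"

text \<open>Finite partial sums express that every row has l1 norm at most \<open>B\<close>, so that
  \<open>mat_app M\<close> acts on bounded sequences.\<close>

definition rows_bounded :: "real \<Rightarrow> (nat \<Rightarrow> nat \<Rightarrow> real) \<Rightarrow> bool" where
  "rows_bounded B M \<longleftrightarrow> (\<forall>m D. finite D \<longrightarrow> (\<Sum>k\<in>D. \<bar>M m k\<bar>) \<le> B)"

lemma rows_bounded_nonneg: "rows_bounded B M \<Longrightarrow> 0 \<le> B"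
  unfolding rows_bounded_def by (metis finite.emptyI sum.empty)

lemma rows_bounded_summable: "rows_bounded B M \<Longrightarrow> summable (\<lambda>k. \<bar>M m k\<bar>)"
  by (intro summableI_nonneg_bounded[where x = B]) (auto simp: rows_bounded_def)

lemma rows_bounded_suminf: "rows_bounded B M \<Longrightarrow> (\<Sum>k. \<bar>M m k\<bar>) \<le> B"
  by (rule suminf_le_const[OF rows_bounded_summable]) (auto simp: rows_bounded_def)

lemma mat_app_summable:
  assumes "rows_bounded B M" "\<And>k. \<bar>v k\<bar> \<le> C"
  shows "summable (\<lambda>k. \<bar>M m k * v k\<bar>)" "summable (\<lambda>k. M m k * v k)"
proof -
  have "summable (\<lambda>k. \<bar>M m k\<bar> * C)"
    using rows_bounded_summable[OF assms(1)] by (rule summable_mult2)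
  then show "summable (\<lambda>k. \<bar>M m k * v k\<bar>)"
    by (rule summable_comparison_test[rotated]) (auto simp: abs_mult assms(2) mult_left_mono)
  then show "summable (\<lambda>k. M m k * v k)" by (rule summable_rabs_cancel)
qed

lemma abs_mat_app_le:
  assumes "rows_bounded B M" "\<And>k. \<bar>v k\<bar> \<le> C"
  shows "\<bar>mat_app M v m\<bar> \<le> B * C"
proof -
  have C: "0 \<le> C" using assms(2)[of 0] by linarith
  have "\<bar>mat_app M v m\<bar> \<le> (\<Sum>k. \<bar>M m k * v k\<bar>)"
    unfolding mat_app_def by (rule summable_rabs[OF mat_app_summable(1)[OF assms]])
  also have "\<dots> \<le> (\<Sum>k. \<bar>M m k\<bar> * C)"
    using mat_app_summable(1)[OF assms] rows_bounded_summable[OF assms(1)]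
    by (intro suminf_le summable_mult2) (auto simp: abs_mult assms(2) mult_left_mono)
  also have "\<dots> \<le> B * C"
    using rows_bounded_suminf[OF assms(1), of m] rows_bounded_summable[OF assms(1)] C
    by (simp add: suminf_mult2[symmetric] mult_right_mono)
  finally show ?thesis .
qed

lemma mat_app_add:
  assumes "rows_bounded B M" "\<And>k. \<bar>v k\<bar> \<le> C" "\<And>k. \<bar>w k\<bar> \<le> D"
  shows "mat_app M (\<lambda>k. v k + w k) m = mat_app M v m + mat_app M w m"
  unfolding mat_app_def
  by (simp add: suminf_add[OF mat_app_summable(2)[OF assms(1,2)] mat_app_summable(2)[OF assms(1,3)]]
      distrib_left)

lemma mat_app_cmult:
  assumes "rows_bounded B M" "\<And>k. \<bar>v k\<bar> \<le> C"
  shows "mat_app M (\<lambda>k. c * v k) m = c * mat_app M v m"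
  unfolding mat_app_def
  by (simp add: suminf_mult[OF mat_app_summable(2)[OF assms]] mult.left_commute)

lemma mat_app_sum:
  assumes "rows_bounded B M" "\<And>i k. i \<in> I \<Longrightarrow> \<bar>v i k\<bar> \<le> C i"
  shows "mat_app M (\<lambda>k. \<Sum>i\<in>I. v i k) m = (\<Sum>i\<in>I. mat_app M (v i) m)"
  unfolding mat_app_def sum_distrib_left
  by (rule suminf_sum) (rule mat_app_summable(2)[OF assms])

lemma mat_app_finite_support:
  assumes "finite D" "\<And>k. k \<notin> D \<Longrightarrow> v k = 0"
  shows "mat_app M v m = (\<Sum>k\<in>D. M m k * v k)"
  unfolding mat_app_def by (rule suminf_finite) (use assms in auto)

definition convergent_matrix :: "nat set \<Rightarrow> (nat \<Rightarrow> nat \<Rightarrow> real) \<Rightarrow> bool" where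
  "convergent_matrix A M \<longleftrightarrow> (\<exists>B. rows_bounded B M) \<and> (\<forall>k. \<exists>l. ((\<lambda>m. M m k) \<longlongrightarrow> l) (along A))"

lemma mat_app_finite_support_tendsto:
  assumes "convergent_matrix A M" "finite D" "\<And>k. k \<notin> D \<Longrightarrow> v k = 0"
  obtains l where "(mat_app M v \<longlongrightarrow> l) (along A)"
proof -
  obtain l where "\<And>k. ((\<lambda>m. M m k) \<longlongrightarrow> l k) (along A)"
    using assms(1) unfolding convergent_matrix_def by metis
  then have "((\<lambda>m. \<Sum>k\<in>D. M m k * v k) \<longlongrightarrow> (\<Sum>k\<in>D. l k * v k)) (along A)"
    by (intro tendsto_intros)
  moreover have "mat_app M v = (\<lambda>m. \<Sum>k\<in>D. M m k * v k)"
    by (rule ext) (rule mat_app_finite_support[OF assms(2,3)])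
  ultimately show thesis using that by simp
qed

section \<open>Sign functions that are not separated by combinations of the others\<close>

lemma abs_sum_single_le:
  fixes f :: "'b \<Rightarrow> real"
  assumes R: "finite R" and disj: "\<And>p q. p \<in> R \<Longrightarrow> q \<in> R \<Longrightarrow> p \<noteq> q \<Longrightarrow> f p = 0 \<or> f q = 0"
    and le: "\<And>p. p \<in> R \<Longrightarrow> \<bar>f p\<bar> \<le> C" and "0 \<le> C"
  shows "\<bar>\<Sum>p\<in>R. f p\<bar> \<le> C"
proof (cases "\<exists>p\<in>R. f p \<noteq> 0")
  case True
  then obtain p where p: "p \<in> R" "f p \<noteq> 0" by blast
  then have "\<forall>q\<in>R - {p}. f q = 0" using disj by blast
  then show ?thesis using le[OF p(1)] by (simp add: sum.remove[OF R p(1)])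
qed (use \<open>0 \<le> C\<close> in simp)

text \<open>The set where \<open>signs A p\<close> equals \<open>s\<close> is almost contained in the zero set of \<open>signs A q\<close>, and
  conversely, so a function separating both would have to be larger on each of two sets than on
  the other.\<close>

lemma finite_separated_new:
  assumes A: "infinite A" and s: "s \<in> {1, -1}" and d: "d > 0"
  shows "finite {p. separates f A (signs A p) s d}"
proof -
  have "p = q" if pq: "separates f A (signs A p) s d" "separates f A (signs A q) s d" for p q
  proof (rule ccontr)
    assume "p \<noteq> q"
    obtain N1 where N1: "\<And>g h. g \<ge> N1 \<Longrightarrow> h \<ge> N1 \<Longrightarrow> g \<in> A \<Longrightarrow> h \<in> A \<Longrightarrow>
        signs A p g = s \<Longrightarrow> signs A p h = 0 \<Longrightarrow> f g - f h \<ge> d"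
      using pq(1) unfolding separates_def by blast
    obtain N2 where N2: "\<And>g h. g \<ge> N2 \<Longrightarrow> h \<ge> N2 \<Longrightarrow> g \<in> A \<Longrightarrow> h \<in> A \<Longrightarrow>
        signs A q g = s \<Longrightarrow> signs A q h = 0 \<Longrightarrow> f g - f h \<ge> d"
      using pq(2) unfolding separates_def by blast
    have "\<exists>g \<ge> max N1 N2. signs A p g = s \<and> signs A q g = 0"
      if "p \<noteq> q" for p q
    proof -
      have "infinite ({k. signs A p k = s} - {k. signs A p k \<noteq> 0 \<and> signs A q k \<noteq> 0})"
        using infinite_signs[OF A s] finite_signs_common[OF A that] by (rule Diff_infinite_finite[rotated])
      then obtain g where "g \<ge> max N1 N2" "g \<in> {k. signs A p k = s} - {k. signs A p k \<noteq> 0 \<and> signs A q k \<noteq> 0}"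
        unfolding infinite_nat_iff_unbounded_le by blast
      then show ?thesis using s by auto
    qed
    then obtain g h where "g \<ge> max N1 N2" "signs A p g = s" "signs A q g = 0"
        "h \<ge> max N1 N2" "signs A q h = s" "signs A p h = 0"
      using \<open>p \<noteq> q\<close> by metis
    moreover have "g \<in> A" "h \<in> A"
      using calculation signs_in[OF A, of p g] signs_in[OF A, of q h] s by auto
    ultimately show False using N1[of g h] N2[of h g] d by auto
  qed
  then have "{p. separates f A (signs A p) s d} \<subseteq> {p}" if "separates f A (signs A p) s d" for p
    using that by blast
  then show ?thesis by (metis (lifting) Collect_empty_eq finite.simps finite_subset)
qed

text \<open>Averaging over many \<open>p\<close> makes the contribution of the almost disjoint \<open>signs D p\<close> negligible.\<close>

lemma finite_separated_old:
  assumes M: "convergent_matrix A M" and D: "infinite D" and w: "\<And>k. \<bar>w k\<bar> \<le> C" and de: "e < d"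
    and not_sep: "\<not> separates (mat_app M w) A v s e"
  shows "finite {p. separates (mat_app M (\<lambda>k. c * signs D p k + w k)) A v s d}"
proof (rule ccontr)
  let ?P = "{p. separates (mat_app M (\<lambda>k. c * signs D p k + w k)) A v s d}"
  assume "infinite ?P"
  obtain B where B: "rows_bounded B M" using M by (auto simp: convergent_matrix_def)
  note Bn = rows_bounded_nonneg[OF B]
  \<comment> \<open>Summing \<open>r\<close> separation inequalities gives a gap
    \<open>r * d\<close>, of which the summed sign functions account for at most
    \<open>\<bar>c\<bar> * (2 * B + 2)\<close>. This \<open>r\<close> leaves more than
    \<open>r * e\<close> to the \<open>r\<close> copies of \<open>w\<close>.\<close>
  obtain r :: nat where r: "real r > \<bar>c\<bar> * (2 * B + 2) / (d - e)" using reals_Archimedean2 by blast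
  obtain R where R: "R \<subseteq> ?P" "finite R" "card R = r"
    using infinite_arbitrarily_large[OF \<open>infinite ?P\<close>] by blast
  have "0 \<le> \<bar>c\<bar> * (2 * B + 2) / (d - e)" using de Bn by auto
  then have "r > 0" using r by linarith
  have rc: "\<bar>c\<bar> * (2 * B + 2) < real r * (d - e)" using r de by (simp add: divide_less_eq mult.commute)
  define W where "W = (\<lambda>k. \<Sum>p\<in>R. signs D p k)"
  define Z where "Z = (\<Union>p\<in>R. \<Union>q\<in>R - {p}. {k. signs D p k \<noteq> 0 \<and> signs D q k \<noteq> 0})"
  have Z: "finite Z" unfolding Z_def using R(2) finite_signs_common[OF D] by (intro finite_UN_I) auto
  have WZ: "\<bar>W k\<bar> \<le> 1" if "k \<notin> Z" for k
    unfolding W_def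
    by (rule abs_sum_single_le[OF R(2)]) (use that abs_signs_le in \<open>auto simp: Z_def\<close>)
  \<comment> \<open>\<open>W\<close> can be large only on the finite set \<open>Z\<close>. The image
    of that part converges, so it varies by less than 2 far out; the remaining part is bounded by 1
    and its image by \<open>B\<close>.\<close>
  define W1 where "W1 = (\<lambda>k. if k \<in> Z then W k else 0)"
  define W2 where "W2 = (\<lambda>k. if k \<in> Z then 0 else W k)"
  have Wr: "\<bar>W k\<bar> \<le> r" for k
  proof -
    have "\<bar>W k\<bar> \<le> (\<Sum>p\<in>R. \<bar>signs D p k\<bar>)" unfolding W_def by (rule sum_abs)
    also have "\<dots> \<le> (\<Sum>p\<in>R. 1)" by (rule sum_mono) (rule abs_signs_le)
    finally show ?thesis using R(3) by simp
  qed
  obtain l where "(mat_app M W1 \<longlongrightarrow> l) (along A)"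
    using mat_app_finite_support_tendsto[OF M Z, of W1] unfolding W1_def by auto
  then have "\<forall>\<^sub>F m in along A. \<bar>mat_app M W1 m - l\<bar> < 1"
    using tendstoD[of _ l _ 1] by (simp add: dist_real_def)
  then obtain N0 where N0: "\<And>m. m \<ge> N0 \<Longrightarrow> m \<in> A \<Longrightarrow> \<bar>mat_app M W1 m - l\<bar> < 1"
    by (auto simp: eventually_along)
  have W12: "mat_app M W m = mat_app M W1 m + mat_app M W2 m" for m
  proof -
    have "W = (\<lambda>k. W1 k + W2 k)" by (auto simp: W1_def W2_def)
    then show ?thesis
      using mat_app_add[OF B, of W1 r W2 r m] Wr by (auto simp: W1_def W2_def)
  qed
  have W2: "\<bar>mat_app M W2 m\<bar> \<le> B" for m
    using abs_mat_app_le[OF B, of W2 1 m] WZ by (auto simp: W2_def)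
  define f where "f = (\<lambda>p. mat_app M (\<lambda>k. c * signs D p k + w k))"
  have cs: "\<bar>c * signs D p k\<bar> \<le> \<bar>c\<bar>" for p k
    using abs_signs_le[of D p k] by (simp add: abs_mult mult_left_le)
  have f: "(\<Sum>p\<in>R. f p m) = c * mat_app M W m + real r * mat_app M w m" for m
  proof -
    have "f p m = mat_app M (\<lambda>k. c * signs D p k) m + mat_app M w m" for p
      unfolding f_def using cs w by (intro mat_app_add[OF B]) auto
    moreover have "mat_app M (\<lambda>k. c * signs D p k) m = c * mat_app M (signs D p) m" for p
      using abs_signs_le by (rule mat_app_cmult[OF B])
    moreover have "mat_app M W m = (\<Sum>p\<in>R. mat_app M (signs D p) m)"
      unfolding W_def using abs_signs_le by (rule mat_app_sum[OF B])
    ultimately show ?thesis using R(3) by (simp add: sum.distrib sum_distrib_left)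
  qed
  have "\<forall>p\<in>R. \<exists>N. \<forall>g h. g \<ge> N \<longrightarrow> h \<ge> N \<longrightarrow> g \<in> A \<longrightarrow> h \<in> A \<longrightarrow> v g = s \<longrightarrow> v h = 0 \<longrightarrow>
      f p g - f p h \<ge> d"
    using R(1) unfolding separates_def f_def by blast
  then obtain N where N: "\<And>p g h. p \<in> R \<Longrightarrow> g \<ge> N p \<Longrightarrow> h \<ge> N p \<Longrightarrow> g \<in> A \<Longrightarrow> h \<in> A \<Longrightarrow> v g = s \<Longrightarrow>
      v h = 0 \<Longrightarrow> f p g - f p h \<ge> d"
    by metis
  have "separates (mat_app M w) A v s e"
    unfolding separates_def
  proof (intro exI allI impI)
    fix g h
    assume g: "Max (insert N0 (N ` R)) \<le> g" "g \<in> A" "v g = s"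
      and h: "Max (insert N0 (N ` R)) \<le> h" "h \<in> A" "v h = 0"
    have "real r * d = (\<Sum>p\<in>R. d)" using R by simp
    also have "\<dots> \<le> (\<Sum>p\<in>R. f p g - f p h)"
      using g h R(2) by (intro sum_mono N) auto
    also have "\<dots> = c * (mat_app M W g - mat_app M W h) + real r * (mat_app M w g - mat_app M w h)"
      by (simp add: sum_subtractf f algebra_simps)
    also have "c * (mat_app M W g - mat_app M W h) \<le> \<bar>c\<bar> * (2 * B + 2)"
    proof -
      have "\<bar>mat_app M W1 g - l\<bar> < 1" "\<bar>mat_app M W1 h - l\<bar> < 1"
        using g h R(2) by (auto intro: N0)
      then have "\<bar>mat_app M W g - mat_app M W h\<bar> \<le> 2 * B + 2"
        using W2[of g] W2[of h] unfolding W12 by linarith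
      then have "\<bar>c * (mat_app M W g - mat_app M W h)\<bar> \<le> \<bar>c\<bar> * (2 * B + 2)"
        by (simp add: abs_mult mult_left_mono)
      then show ?thesis by linarith
    qed
    finally have "real r * e < real r * (mat_app M w g - mat_app M w h)"
      using rc by (simp add: algebra_simps)
    then show "e \<le> mat_app M w g - mat_app M w h" using \<open>r > 0\<close> by simp
  qed
  with not_sep show False by contradiction
qed

lemma uncountable_UNIV_nat_set: "uncountable (UNIV :: nat set set)"
  by (metis Cantors_theorem Pow_UNIV UNIV_not_empty uncountable_def)

text \<open>The margin \<open>1 / (j + 1)\<close> above \<open>1/4\<close> leaves room for the loss in \<open>finite_separated_old\<close> while
  keeping the prohibitions countable.\<close>

theorem nonseparated_signs:
  fixes M :: "nat set \<Rightarrow> nat \<Rightarrow> nat \<Rightarrow> real" and A :: "nat set \<Rightarrow> nat set"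
  assumes A: "\<And>t. infinite (A t)"
  obtains g where
    "\<And>F t c s j. finite F \<Longrightarrow> t \<notin> F \<Longrightarrow> convergent_matrix (A t) (M t) \<Longrightarrow> (\<And>u. u \<in> F \<Longrightarrow> c u \<in> \<rat>) \<Longrightarrow>
       s \<in> {1, -1} \<Longrightarrow>
       \<not> separates (mat_app (M t) (\<lambda>k. \<Sum>u\<in>F. c u * signs (A u) (g u) k)) (A t)
           (signs (A t) (g t)) s (1/4 + 1 / (real j + 1))"
proof -
  \<comment> \<open>Dropping \<open>t\<close> from the sum lets one finite set hold both the target
    \<open>t\<close> and the indices of the combination, as the selection theorem requires.\<close>
  define sep where "sep = (\<lambda>F g t c s j. convergent_matrix (A t) (M t) \<and>
    separates (mat_app (M t) (\<lambda>k. \<Sum>u\<in>F - {t}. c u * signs (A u) (g u) k)) (A t)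
       (signs (A t) (g t)) s (1/4 + 1 / (real j + 1)))"
  define bad where "bad = (\<lambda>F g. \<exists>t\<in>F. \<exists>c s j. (\<forall>u\<in>F. c u \<in> \<rat>) \<and> s \<in> {1, -1} \<and> sep F g t c s (j::nat))"
  have sep_cong: "sep F g t c s j \<longleftrightarrow> sep F h t c' s j"
    if "t \<in> F" "\<And>x. x \<in> F \<Longrightarrow> g x = h x" "\<And>x. x \<in> F \<Longrightarrow> c x = c' x" for F g h t c c' s j
  proof -
    have "(\<Sum>u\<in>F - {t}. c u * signs (A u) (g u) k) = (\<Sum>u\<in>F - {t}. c' u * signs (A u) (h u) k)" for k
      using that by (intro sum.cong) auto
    then show ?thesis using that(1,2) by (simp add: sep_def)
  qed
  \<comment> \<open>Either the new index is the target, whose signs vary while the combination is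
    fixed, or it contributes the new summand \<open>c x * signs (A x) p\<close>. The two finiteness
    lemmas cover these cases.\<close>
  have fin: "finite {p. sep (insert x F) (g(x := p)) t c s j}"
    if F: "finite F" "x \<notin> F" "\<not> bad F g" and t: "t \<in> insert x F"
      and c: "\<And>u. u \<in> insert x F \<Longrightarrow> c u \<in> \<rat>" and s: "s \<in> {1, -1}" for F x g t c s j
  proof (cases "t = x")
    case True
    have "(\<Sum>u\<in>F. c u * signs (A u) ((g(x := p)) u) k) = (\<Sum>u\<in>F. c u * signs (A u) (g u) k)" for p k
      using F by (intro sum.cong) auto
    moreover have "insert x F - {t} = F" using F True by auto
    ultimately have "{p. sep (insert x F) (g(x := p)) t c s j} \<subseteq>
        {p. separates (mat_app (M x) (\<lambda>k. \<Sum>u\<in>F. c u * signs (A u) (g u) k)) (A x)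
             (signs (A x) p) s (1/4 + 1 / (real j + 1))}"
      unfolding sep_def using True by auto
    moreover have "1/4 + 1 / (real j + 1) > 0" by (simp add: add_pos_pos)
    ultimately show ?thesis
      using finite_separated_new[OF A s] finite_subset by blast
  next
    case False
    then have tF: "t \<in> F" using t by auto
    define w where "w = (\<lambda>k. \<Sum>u\<in>F - {t}. c u * signs (A u) (g u) k)"
    show ?thesis
    proof (cases "convergent_matrix (A t) (M t)")
      case True
      have w: "\<bar>w k\<bar> \<le> (\<Sum>u\<in>F - {t}. \<bar>c u\<bar>)" for k
      proof -
        have "\<bar>w k\<bar> \<le> (\<Sum>u\<in>F - {t}. \<bar>c u * signs (A u) (g u) k\<bar>)" unfolding w_def by (rule sum_abs)
        also have "\<dots> \<le> (\<Sum>u\<in>F - {t}. \<bar>c u\<bar>)"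
          by (intro sum_mono) (simp add: abs_mult mult_left_le abs_signs_le)
        finally show ?thesis .
      qed
      \<comment> \<open>The parameter \<open>2 * j + 1\<close> halves the margin
        \<open>1 / (j + 1)\<close>, which yields the strict inequality between the two
        thresholds.\<close>
      have "\<not> sep F g t c s (2 * j + 1)" using F(3) tF c s unfolding bad_def by blast
      then have "\<not> separates (mat_app (M t) w) (A t) (signs (A t) (g t)) s (1/4 + 1 / (real (2 * j + 1) + 1))"
        using True by (simp add: sep_def w_def)
      then have *: "finite {p. separates (mat_app (M t) (\<lambda>k. c x * signs (A x) p k + w k)) (A t)
          (signs (A t) (g t)) s (1/4 + 1 / (real j + 1))}"
        by (intro finite_separated_old[OF True A w]) (auto simp: field_simps)
      have "insert x F - {t} = insert x (F - {t})" using False by auto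
      moreover have "(\<Sum>u\<in>F - {t}. c u * signs (A u) ((g(x := p)) u) k) = w k" for p k
        unfolding w_def using F by (intro sum.cong) auto
      ultimately have "(\<Sum>u\<in>insert x F - {t}. c u * signs (A u) ((g(x := p)) u) k) =
          c x * signs (A x) p k + w k" for p k
        using F by (simp only: sum.insert finite_Diff) simp
      then show ?thesis using * False by (simp add: sep_def)
    next
      case False
      then show ?thesis by (simp add: sep_def)
    qed
  qed
  obtain g where g: "\<And>F. finite F \<Longrightarrow> \<not> bad F g"
  proof (rule generic_selection[of bad])
    show "uncountable (UNIV :: nat set set)" by (rule uncountable_UNIV_nat_set)
    show "bad F h" if "\<And>x. x \<in> F \<Longrightarrow> g x = h x" "bad F g" for F g h
      using that sep_cong[of _ F g h] unfolding bad_def by metis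
    show "\<not> bad {} g" for g by (simp add: bad_def)
    show "countable {p. bad (insert x F) (g(x := p))}" if F: "finite F" "x \<notin> F" "\<not> bad F g" for F x g
    proof -
      let ?G = "insert x F"
      \<comment> \<open>Only the coefficients on the finite set \<open>?G\<close> matter;
        \<open>restrict\<close> turns them into members of a countable \<open>PiE\<close>, so
        countably many finite sets cover the prohibited values.\<close>
      have "{p. bad ?G (g(x := p))} \<subseteq> (\<Union>t\<in>?G. \<Union>c\<in>PiE ?G (\<lambda>_. \<rat>). \<Union>s\<in>{1, -1}. \<Union>j.
          {p. sep ?G (g(x := p)) t c s j})"
      proof
        fix p assume "p \<in> {p. bad ?G (g(x := p))}"
        then obtain t c s j where *: "t \<in> ?G" "\<forall>u\<in>?G. c u \<in> \<rat>" "s \<in> {1, -1}" "sep ?G (g(x := p)) t c s j"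
          unfolding bad_def by blast
        then have 1: "sep ?G (g(x := p)) t (restrict c ?G) s j"
          using sep_cong[of t ?G "g(x := p)" "g(x := p)" c "restrict c ?G" s j] by auto
        have 2: "restrict c ?G \<in> PiE ?G (\<lambda>_. \<rat>)" using * by (auto simp: PiE_def)
        show "p \<in> (\<Union>t\<in>?G. \<Union>c\<in>PiE ?G (\<lambda>_. \<rat>). \<Union>s\<in>{1, -1}. \<Union>j.
          {p. sep ?G (g(x := p)) t c s j})"
          by (rule UN_I[OF *(1)], rule UN_I[OF 2], rule UN_I[OF *(3)], rule UN_I[OF UNIV_I], rule CollectI, rule 1)
      qed
      moreover have "countable \<dots>"
      proof (intro countable_UN)
        show "countable ?G" using F by (simp add: countable_finite)
        show "countable (PiE ?G (\<lambda>_. \<rat>))" using F by (intro countable_PiE countable_rat) auto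
        fix t and c :: "nat set \<Rightarrow> real" and s and j :: nat
        assume "t \<in> ?G" "c \<in> PiE ?G (\<lambda>_. \<rat>)" "s \<in> {1, -1 :: real}"
        then show "countable {p. sep ?G (g(x := p)) t c s j}"
          by (intro countable_finite fin[OF F]) auto
      qed auto
      ultimately show ?thesis by (rule countable_subset)
    qed
  qed blast
  show thesis
  proof (rule that[of g])
    fix F t and c :: "nat set \<Rightarrow> real" and s and j :: nat
    assume F: "finite F" "t \<notin> F" and conv: "convergent_matrix (A t) (M t)"
      and c: "\<And>u. u \<in> F \<Longrightarrow> c u \<in> \<rat>" and s: "s \<in> {1, -1 :: real}"
    \<comment> \<open>The coefficient at \<open>t\<close> is unrestricted; resetting it to 0 makes
      it rational, and \<open>sep\<close> drops its summand anyway.\<close>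
    have "\<forall>u\<in>insert t F. (c(t := 0)) u \<in> \<rat>" using c by simp
    then have "\<not> sep (insert t F) g t (c(t := 0)) s j"
      using g[of "insert t F"] F(1) s unfolding bad_def by blast
    moreover have "insert t F - {t} = F" using F by auto
    moreover have "(\<Sum>u\<in>F. (c(t := 0)) u * signs (A u) (g u) k) = (\<Sum>u\<in>F. c u * signs (A u) (g u) k)" for k
      using F by (intro sum.cong) auto
    ultimately show "\<not> separates (mat_app (M t) (\<lambda>k. \<Sum>u\<in>F. c u * signs (A u) (g u) k)) (A t)
           (signs (A t) (g t)) s (1/4 + 1 / (real j + 1))"
      using conv by (simp add: sep_def)
  qed
qed

text \<open>The uncountable fibres allow an index that avoids any given countable set.\<close>

lemma nat_set_coding:
  obtains code :: "nat set \<Rightarrow> (nat \<Rightarrow> nat \<Rightarrow> real) \<times> (nat \<Rightarrow> nat \<Rightarrow> real)"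
  where "\<And>w. uncountable {x. code x = w}"
proof -
  \<comment> \<open>Left cuts in the rationals code a real by a set of naturals; \<open>h\<close>
    then merges a sequence of such sets into one.\<close>
  define r :: "real \<Rightarrow> nat set" where "r = (\<lambda>x. {n. from_nat_into \<rat> n < x})"
  have r: "inj r"
  proof (rule injI, rule ccontr)
    have lt: "r x \<noteq> r y" if xy: "x < y" for x y
    proof -
      obtain q where q: "q \<in> \<rat>" "x < q" "q < y" using Rats_dense_in_real[OF xy] by blast
      moreover obtain n where "from_nat_into \<rat> n = q"
        using q(1) from_nat_into_surj[OF countable_rat] by blast
      ultimately have "n \<in> r y" "n \<notin> r x" by (auto simp: r_def)
      then show ?thesis by blast
    qed
    fix x y assume "r x = r y" "x \<noteq> y"
    then show False using lt[of x y] lt[of y x] by (metis linorder_neqE)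
  qed
  define h :: "(nat \<Rightarrow> nat set) \<Rightarrow> nat set" where "h = (\<lambda>f. {prod_encode (k, n) | k n. n \<in> f k})"
  have h_mem: "prod_encode (k, n) \<in> h f \<longleftrightarrow> n \<in> f k" for k n f by (auto simp: h_def)
  have h: "inj h"
    by (rule injI, rule ext, rule set_eqI) (metis h_mem)
  define m where "m = (\<lambda>M. h (\<lambda>i. h (\<lambda>j. r (M i j))))"
  have m: "inj m"
    unfolding m_def by (rule injI) (simp add: inj_eq[OF h] inj_eq[OF r] fun_eq_iff)
  \<comment> \<open>The last component is forgotten on decoding; letting it range over all sets of
    naturals makes the fibres uncountable.\<close>
  define e where "e = (\<lambda>((M, M'), x). h (\<lambda>k. if k = 0 then m M else if k = 1 then m M' else x))"
  have e: "inj e"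
  proof (rule injI, clarsimp simp: e_def inj_eq[OF h])
    fix M M' x N N' y
    assume "(\<lambda>k. if k = 0 then m M else if k = 1 then m M' else x) =
      (\<lambda>k. if k = 0 then m N else if k = (1::nat) then m N' else y)"
    from fun_cong[OF this, of 0] fun_cong[OF this, of 1] fun_cong[OF this, of 2]
    show "M = N \<and> M' = N' \<and> x = y" by (simp add: inj_eq[OF m])
  qed
  show thesis
  proof (rule that[of "\<lambda>x. fst (inv e x)"])
    fix w
    have "range (\<lambda>x. e (w, x)) \<subseteq> {x. fst (inv e x) = w}" using e by auto
    moreover have "inj (\<lambda>x. e (w, x))" by (rule injI) (simp add: inj_eq[OF e])
    ultimately show "uncountable {x. fst (inv e x) = w}"
      using countable_subset countable_image_inj_on uncountable_UNIV_nat_set by metis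
  qed
qed

section \<open>Thinning a set until a matrix is nearly diagonal along it\<close>

lemma tendsto_along_range:
  assumes "strict_mono (r :: nat \<Rightarrow> nat)" "(\<lambda>n. f (r n)) \<longlonglongrightarrow> (l :: real)"
  shows "(f \<longlongrightarrow> l) (along (range r))"
proof (rule tendstoI)
  fix e :: real assume "e > 0"
  then obtain N where N: "\<And>n. n \<ge> N \<Longrightarrow> dist (f (r n)) l < e"
    using assms(2) by (auto simp: lim_sequentially)
  then have "dist (f m) l < e" if "m \<ge> r N" "m \<in> range r" for m
    using that assms(1) by (auto simp: strict_mono_less_eq)
  then show "\<forall>\<^sub>F m in along (range r). dist (f m) l < e"
    by (auto simp: eventually_along)
qed

text \<open>Each new term faces finitely many demands from the earlier ones, and every demand holds
  for all large numbers.\<close>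

lemma eventually_subsequence_choice:
  fixes R :: "nat \<Rightarrow> nat \<Rightarrow> nat \<Rightarrow> nat \<Rightarrow> bool"
  assumes "\<And>i j x. eventually (R i j x) sequentially" "\<And>j. eventually (Q j) sequentially"
  obtains f where "strict_mono f" "\<And>i j. i < j \<Longrightarrow> R i j (f i) (f j)" "\<And>j. Q j (f j)"
proof -
  have "\<exists>f. \<forall>j. Q j (f j) \<and> (\<forall>i<j. f i < f j \<and> R i j (f i) (f j))"
  proof (rule dependent_wf_choice[OF wf_less_than])
    fix j f
    have "\<forall>\<^sub>F y in sequentially. Q j y \<and> (\<forall>i\<in>{..<j}. f i < y \<and> R i j (f i) y)"
      using assms eventually_gt_at_top
      by (intro eventually_conj eventually_ball_finite) (auto intro: eventually_conj)
    then show "\<exists>y. Q j y \<and> (\<forall>i<j. f i < y \<and> R i j (f i) y)"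
      using eventually_happens'[OF sequentially_bot] by fastforce
  qed auto
  then show thesis using that by (metis strict_monoI)
qed

text \<open>Rows and columns share the threshold \<open>N\<close>. Earlier columns are not
  controlled here; \<open>convergent_matrix\<close> takes care of them.\<close>

definition nearly_diagonal :: "nat set \<Rightarrow> (nat \<Rightarrow> nat \<Rightarrow> real) \<Rightarrow> bool" where
  "nearly_diagonal A M \<longleftrightarrow> (\<forall>e>0. \<exists>N. \<forall>m\<in>A. m \<ge> N \<longrightarrow>
     (\<forall>D. finite D \<longrightarrow> D \<subseteq> {k \<in> A. k \<ge> N \<and> k \<noteq> m} \<longrightarrow> (\<Sum>k\<in>D. \<bar>M m k\<bar>) \<le> e))"

definition tame :: "nat set \<Rightarrow> (nat \<Rightarrow> nat \<Rightarrow> real) \<Rightarrow> (nat \<Rightarrow> nat \<Rightarrow> real) \<Rightarrow> bool" where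
  "tame A M M' \<longleftrightarrow> infinite A \<and> convergent_matrix A M \<and> nearly_diagonal A M \<and>
     (\<forall>j. \<exists>l. ((\<lambda>m. M' m j) \<longlongrightarrow> l) (along A)) \<and> (\<exists>a. ((\<lambda>m. M m m) \<longlongrightarrow> a) (along A))"

lemma sum_half_powers_le: "(\<Sum>j\<in>{N..<n}. (1/2 :: real)^j) \<le> 2 * (1/2)^N"
proof (cases "N \<le> n")
  case True
  then have "(\<Sum>j\<in>{N..<n}. (1/2 :: real)^j) = 2 * (1/2)^N - 2 * (1/2)^n"
    by (induction n rule: dec_induct) simp_all
  then show ?thesis by simp
qed simp

text \<open>After a diagonal extraction the columns converge. Their limits are summable and each row
  tends to 0, so a sparse enough subsequence makes the off-diagonal entries geometrically
  small.\<close>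

lemma tame_subset:
  assumes A: "infinite A" and B: "rows_bounded B M" and B': "\<And>m j. \<bar>M' m j\<bar> \<le> B'"
  obtains A' where "A' \<subseteq> A" "tame A' M M'"
proof -
  have MB: "\<bar>M m k\<bar> \<le> B" for m k
    using B[unfolded rows_bounded_def, rule_format, of "{k}" m] by simp
  \<comment> \<open>One countable index type collects the columns of \<open>M\<close>, its diagonal
    (\<open>Inr None\<close>) and the columns of \<open>M'\<close>, so a single extraction serves
    all three.\<close>
  define f where "f = (\<lambda>i x. case x of Inl k \<Rightarrow> M (enumerate A i) k | Inr None \<Rightarrow> M (enumerate A i) (enumerate A i)
    | Inr (Some j) \<Rightarrow> M' (enumerate A i) j)"
  have fB: "norm (f i x) \<le> max B B'" for i x
    using MB B' by (auto simp: f_def le_max_iff_disj split: sum.splits option.splits)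
  then obtain k :: "nat \<Rightarrow> nat" where k: "strict_mono k" "\<And>x. \<exists>l. (\<lambda>n. f (k n) x) \<longlonglongrightarrow> l"
    using function_convergent_subsequence[of "UNIV :: (nat + nat option) set" f "max B B'", OF _ fB]
    by (metis UNIV_I countableI_type)
  define e where "e = enumerate A \<circ> k"
  have e: "strict_mono e"
    unfolding e_def using strict_mono_enumerate[OF A] k(1) by (rule strict_mono_o)
  have eA: "range e \<subseteq> A" using enumerate_in_set[OF A] by (auto simp: e_def)
  have "\<exists>l. (\<lambda>n. M (e n) j) \<longlonglongrightarrow> l" for j using k(2)[of "Inl j"] by (simp add: f_def e_def)
  then obtain \<nu> where \<nu>: "\<And>j. (\<lambda>n. M (e n) j) \<longlonglongrightarrow> \<nu> j" by metis
  have M': "\<exists>l. (\<lambda>n. M' (e n) j) \<longlonglongrightarrow> l" for j using k(2)[of "Inr (Some j)"] by (simp add: f_def e_def)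
  have diag: "\<exists>l. (\<lambda>n. M (e n) (e n)) \<longlonglongrightarrow> l" using k(2)[of "Inr None"] by (simp add: f_def e_def)
  have "(\<Sum>j\<in>D. \<bar>\<nu> j\<bar>) \<le> B" if "finite D" for D
  proof (rule LIMSEQ_le_const2)
    show "(\<lambda>n. \<Sum>j\<in>D. \<bar>M (e n) j\<bar>) \<longlonglongrightarrow> (\<Sum>j\<in>D. \<bar>\<nu> j\<bar>)" by (intro tendsto_intros \<nu>)
    show "\<exists>N. \<forall>n\<ge>N. (\<Sum>j\<in>D. \<bar>M (e n) j\<bar>) \<le> B" using B that by (auto simp: rows_bounded_def)
  qed
  then have "summable (\<lambda>j. \<bar>\<nu> j\<bar>)" by (intro summableI_nonneg_bounded[where x = B]) auto
  then have "(\<lambda>j. \<bar>\<nu> j\<bar>) \<longlonglongrightarrow> 0" by (rule summable_LIMSEQ_zero)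
  then have \<nu>0: "(\<lambda>n. \<bar>\<nu> (e n)\<bar>) \<longlonglongrightarrow> 0" using filterlim_subseq[OF e] by (rule filterlim_compose)
  have row0: "(\<lambda>n. \<bar>M m (e n)\<bar>) \<longlonglongrightarrow> 0" for m
    using summable_LIMSEQ_zero[OF rows_bounded_summable[OF B]] filterlim_subseq[OF e]
    by (rule filterlim_compose)
  \<comment> \<open>Above the diagonal, smallness comes from the decay of the rows; below it, from
    closeness to the column limit. Both bounds are powers in the index of the column, so row sums
    are geometric.\<close>
  define R where "R = (\<lambda>i j x y. \<bar>M (e x) (e y)\<bar> < (1/2)^j \<and> \<bar>M (e y) (e x) - \<nu> (e x)\<bar> < (1/2)^i)"
  obtain g where g: "strict_mono g" "\<And>i j. i < j \<Longrightarrow> R i j (g i) (g j)" "\<And>j. \<bar>\<nu> (e (g j))\<bar> < (1/2)^j"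
  proof (rule eventually_subsequence_choice[of R "\<lambda>j y. \<bar>\<nu> (e y)\<bar> < (1/2)^j"])
    show "eventually (R i j x) sequentially" for i j x
      unfolding R_def
    proof (rule eventually_conj)
      show "\<forall>\<^sub>F y in sequentially. \<bar>M (e x) (e y)\<bar> < (1/2)^j"
        using order_tendstoD(2)[OF row0] by simp
      show "\<forall>\<^sub>F y in sequentially. \<bar>M (e y) (e x) - \<nu> (e x)\<bar> < (1/2)^i"
        using tendstoD[OF \<nu>[of "e x"], of "(1/2)^i"] by (simp add: dist_real_def)
    qed
    show "\<forall>\<^sub>F y in sequentially. \<bar>\<nu> (e y)\<bar> < (1/2)^j" for j
      using order_tendstoD(2)[OF \<nu>0] by simp
  qed blast
  define d where "d = e \<circ> g"
  have d: "strict_mono d" unfolding d_def using e g(1) by (rule strict_mono_o)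
  have lim: "((F \<circ> e) \<longlonglongrightarrow> l) \<Longrightarrow> (F \<longlongrightarrow> l) (along (range d))" for F :: "nat \<Rightarrow> real" and l
    using LIMSEQ_subseq_LIMSEQ[OF _ g(1), of "F \<circ> e" l] tendsto_along_range[OF d, of F l]
    by (simp add: d_def o_def)
  have Md: "\<bar>M (d i) (d j)\<bar> \<le> 2 * (1/2)^j" if "i \<noteq> j" for i j
  proof (cases "i < j")
    case True
    then have "\<bar>M (d i) (d j)\<bar> < (1/2)^j" using g(2)[OF True] by (simp add: R_def d_def)
    then show ?thesis using zero_less_power[of "1/2::real" j] by linarith
  next
    case False
    then have "R j i (g j) (g i)" using g(2)[of j i] that by simp
    then have "\<bar>M (d i) (d j) - \<nu> (d j)\<bar> < (1/2)^j" by (simp add: R_def d_def)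
    moreover have "\<bar>\<nu> (d j)\<bar> < (1/2)^j" using g(3) by (simp add: d_def)
    ultimately show ?thesis by linarith
  qed
  have "nearly_diagonal (range d) M"
    unfolding nearly_diagonal_def
  proof (intro allI impI)
    fix \<epsilon> :: real assume "\<epsilon> > 0"
    then obtain N where N: "(1/2 :: real)^N < \<epsilon> / 4"
      using real_arch_pow_inv[of "\<epsilon> / 4" "1/2"] by auto
    show "\<exists>N. \<forall>m\<in>range d. m \<ge> N \<longrightarrow> (\<forall>D. finite D \<longrightarrow> D \<subseteq> {k \<in> range d. k \<ge> N \<and> k \<noteq> m} \<longrightarrow>
        (\<Sum>k\<in>D. \<bar>M m k\<bar>) \<le> \<epsilon>)"
    proof (intro exI[of _ "d N"] ballI allI impI)
      fix m D assume m: "m \<in> range d" and D: "finite D" "D \<subseteq> {k \<in> range d. k \<ge> d N \<and> k \<noteq> m}"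
      obtain i where i: "m = d i" using m by blast
      define J where "J = d -` D"
      have J: "finite J" "D = d ` J"
        using D strict_mono_imp_inj_on[OF d] by (auto simp: J_def intro!: finite_vimageI)
      have JN: "j \<ge> N" "j \<noteq> i" if "j \<in> J" for j
        using that D i strict_mono_less_eq[OF d] by (auto simp: J_def)
      have "(\<Sum>k\<in>D. \<bar>M m k\<bar>) = (\<Sum>j\<in>J. \<bar>M (d i) (d j)\<bar>)"
        unfolding J(2) i by (rule sum.reindex_cong[of d]) (auto intro: inj_on_subset[OF strict_mono_imp_inj_on[OF d]])
      also have "\<dots> \<le> (\<Sum>j\<in>J. 2 * (1/2)^j)"
        using JN by (intro sum_mono Md) auto
      also have "\<dots> \<le> (\<Sum>j\<in>{N..<Suc (Max (insert N J))}. 2 * (1/2 :: real)^j)"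
        using J JN by (intro sum_mono2) (auto simp: less_Suc_eq_le)
      also have "\<dots> = 2 * (\<Sum>j\<in>{N..<Suc (Max (insert N J))}. (1/2 :: real)^j)"
        by (simp add: sum_distrib_left)
      also have "\<dots> \<le> 4 * (1/2)^N"
        using sum_half_powers_le[of N "Suc (Max (insert N J))"] by simp
      finally show "(\<Sum>k\<in>D. \<bar>M m k\<bar>) \<le> \<epsilon>" using N by linarith
    qed
  qed
  moreover have "infinite (range d)" using d by (simp add: range_inj_infinite strict_mono_imp_inj_on)
  moreover have "convergent_matrix (range d) M"
    using B \<nu> lim[of "\<lambda>m. M m _"] unfolding convergent_matrix_def by (auto simp: o_def)
  moreover have "\<exists>l. ((\<lambda>m. M' m j) \<longlongrightarrow> l) (along (range d))" for j
    using M'[of j] lim[of "\<lambda>m. M' m j"] by (auto simp: o_def)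
  moreover have "\<exists>l. ((\<lambda>m. M m m) \<longlongrightarrow> l) (along (range d))"
    using diag lim[of "\<lambda>m. M m m"] by (auto simp: o_def)
  ultimately have "tame (range d) M M'" by (auto simp: tame_def)
  moreover have "range d \<subseteq> A" using eA by (auto simp: d_def)
  ultimately show thesis by (rule that[rotated])
qed

text \<open>The matrix \<open>M'\<close> only records columns that have to converge along \<open>A\<close> as well.\<close>

theorem adversarial_family:
  obtains v :: "nat set \<Rightarrow> nat \<Rightarrow> real" where
    "\<And>x k. v x k \<in> {-1, 0, 1}"
    "\<And>x. infinite {k. v x k = 1}"
    "\<And>x y. x \<noteq> y \<Longrightarrow> finite {k. v x k \<noteq> 0 \<and> v y k \<noteq> 0}"
    "\<And>M M' B B' C. rows_bounded B M \<Longrightarrow> (\<And>m j. \<bar>M' m j\<bar> \<le> B') \<Longrightarrow> countable C \<Longrightarrow>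
       \<exists>x A. x \<notin> C \<and> tame A M M' \<and> (\<forall>k. v x k \<noteq> 0 \<longrightarrow> k \<in> A) \<and>
         (\<forall>F c s. finite F \<longrightarrow> x \<notin> F \<longrightarrow> (\<forall>u\<in>F. c u \<in> \<rat>) \<longrightarrow> s \<in> {1, -1} \<longrightarrow>
            \<not> separates (mat_app M (\<lambda>k. \<Sum>u\<in>F. c u * v u k)) A (v x) s (1/2))"
proof -
  obtain code :: "nat set \<Rightarrow> (nat \<Rightarrow> nat \<Rightarrow> real) \<times> (nat \<Rightarrow> nat \<Rightarrow> real)"
    where code: "\<And>w. uncountable {x. code x = w}"
    using nat_set_coding by blast
  define good where "good = (\<lambda>x A. A \<subseteq> range (branch x) \<and> tame A (fst (code x)) (snd (code x)))"
  \<comment> \<open>Staying inside the branch of \<open>x\<close> keeps distinct indices almost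
    disjoint. Where no tame subset exists, the whole branch is the default, so that
    \<open>A x\<close> is always infinite.\<close>
  define A where "A = (\<lambda>x. if Ex (good x) then SOME A. good x A else range (branch x))"
  have A_sub: "A x \<subseteq> range (branch x)" and A_inf: "infinite (A x)" for x
    using someI_ex[of "good x"] range_inj_infinite[OF inj_branch, of x]
    by (auto simp: A_def good_def tame_def)
  obtain g where g:
    "\<And>F t c s j. finite F \<Longrightarrow> t \<notin> F \<Longrightarrow> convergent_matrix (A t) (fst (code t)) \<Longrightarrow>
       (\<And>u. u \<in> F \<Longrightarrow> c u \<in> \<rat>) \<Longrightarrow> s \<in> {1, -1} \<Longrightarrow>
       \<not> separates (mat_app (fst (code t)) (\<lambda>k. \<Sum>u\<in>F. c u * signs (A u) (g u) k)) (A t)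
           (signs (A t) (g t)) s (1/4 + 1 / (real j + 1))"
    by (rule nonseparated_signs[of A "\<lambda>t. fst (code t)", OF A_inf]) blast
  show thesis
  proof (rule that[of "\<lambda>x. signs (A x) (g x)"])
    show "finite {k. signs (A x) (g x) k \<noteq> 0 \<and> signs (A y) (g y) k \<noteq> 0}" if "x \<noteq> y" for x y
    proof (rule finite_subset[OF _ finite_branch_Int[OF that]])
      show "{k. signs (A x) (g x) k \<noteq> 0 \<and> signs (A y) (g y) k \<noteq> 0} \<subseteq> range (branch x) \<inter> range (branch y)"
        using A_sub[of x] A_sub[of y] signs_in[OF A_inf] by blast
    qed
    fix M M' :: "nat \<Rightarrow> nat \<Rightarrow> real" and B B' C
    assume M: "rows_bounded B M" and M': "\<And>m j. \<bar>M' m j\<bar> \<le> (B' :: real)" and C: "countable (C :: nat set set)"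
    have "\<not> {x. code x = (M, M')} \<subseteq> C" using code countable_subset[OF _ C] by blast
    then obtain x where x: "x \<notin> C" "code x = (M, M')" by blast
    obtain A' where "A' \<subseteq> range (branch x)" "tame A' M M'"
      by (rule tame_subset[OF range_inj_infinite[OF inj_branch] M M'])
    then have ex: "Ex (good x)" using x(2) by (auto simp: good_def)
    then have "good x (A x)" using someI_ex[of "good x"] by (simp add: A_def)
    then have tame: "tame (A x) M M'" using x(2) by (simp add: good_def)
    then have conv: "convergent_matrix (A x) (fst (code x))" using x(2) by (simp add: tame_def)
    \<comment> \<open>With \<open>j = 3\<close> the threshold is
      \<open>1/4 + 1/4 = 1/2\<close>.\<close>
    have "\<not> separates (mat_app M (\<lambda>k. \<Sum>u\<in>F. c u * signs (A u) (g u) k)) (A x) (signs (A x) (g x)) s (1/2)"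
      if "finite F" "x \<notin> F" "\<forall>u\<in>F. c u \<in> \<rat>" "s \<in> {1, -1}" for F c s
      using g[OF that(1,2) conv _ that(4), of c 3] that(3) x(2) by simp
    then show "\<exists>z E. z \<notin> C \<and> tame E M M' \<and> (\<forall>k. signs (A z) (g z) k \<noteq> 0 \<longrightarrow> k \<in> E) \<and>
         (\<forall>F c s. finite F \<longrightarrow> z \<notin> F \<longrightarrow> (\<forall>u\<in>F. c u \<in> \<rat>) \<longrightarrow> s \<in> {1, -1} \<longrightarrow>
            \<not> separates (mat_app M (\<lambda>k. \<Sum>u\<in>F. c u * signs (A u) (g u) k)) E (signs (A z) (g z)) s (1/2))"
      using x(1) tame signs_in[OF A_inf] by blast
  qed (rule signs_cases infinite_signs[OF A_inf], simp?)+
qed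

section \<open>One-point compactifications of \<open>\<Psi>\<close>-spaces\<close>

lemma topspace_derivative: "topspace (derivative X) = {x \<in> topspace X. \<not> openin X {x}}"
  by (auto simp: derivative_def)

lemma continuous_indicator_clopen:
  assumes "openin X C" "closedin X C"
  shows "continuous_map X euclideanreal (indicator C)"
  unfolding continuous_map_def
proof (intro conjI allI impI)
  fix U :: "real set"
  have "{x \<in> topspace X. indicator C x \<in> U} = (if 1 \<in> U then C else {}) \<union> (if 0 \<in> U then topspace X - C else {})"
    using openin_subset[OF assms(1)] by (auto simp: indicator_def)
  then show "openin X {x \<in> topspace X. indicator C x \<in> U}"
    using assms by (auto simp: closedin_def intro!: openin_Un)
qed auto

text \<open>Isolated points, limits and the point at infinity are embedded in an arbitrary carrier,
  so one construction yields both \<open>K\<close> and \<open>L\<close>.\<close>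

locale psi_space =
  fixes pt :: "'n::countable \<Rightarrow> 'a" and lim :: "'g \<Rightarrow> 'a" and om :: 'a and G :: "'g \<Rightarrow> 'n set"
  assumes inj_pt: "inj pt" and inj_lim: "inj lim"
    and distinct: "pt n \<noteq> lim g" "pt n \<noteq> om" "lim g \<noteq> om"
    and infinite_G: "infinite (G g)"
    and almost_disjoint: "g \<noteq> h \<Longrightarrow> finite (G g \<inter> G h)"
begin

definition points :: "'a set" where
  "points = range pt \<union> range lim \<union> {om}"

definition is_open :: "'a set \<Rightarrow> bool" where
  "is_open U \<longleftrightarrow> U \<subseteq> points \<and> (\<forall>g. lim g \<in> U \<longrightarrow> finite {n \<in> G g. pt n \<notin> U}) \<and>
     (om \<in> U \<longrightarrow> (\<exists>H. finite H \<and> (\<forall>g. g \<notin> H \<longrightarrow> lim g \<in> U) \<and> finite {n. pt n \<notin> U \<and> n \<notin> \<Union> (G ` H)}))"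

definition psi :: "'a topology" where
  "psi = topology is_open"

lemma is_openI:
  assumes "U \<subseteq> points" "\<And>g. lim g \<in> U \<Longrightarrow> finite {n \<in> G g. pt n \<notin> U}"
    "om \<in> U \<Longrightarrow> \<exists>H. finite H \<and> (\<forall>g. g \<notin> H \<longrightarrow> lim g \<in> U) \<and> finite {n. pt n \<notin> U \<and> n \<notin> \<Union> (G ` H)}"
  shows "is_open U"
  using assms by (auto simp: is_open_def)

lemma openin_psi: "openin psi U \<longleftrightarrow> is_open U"
proof -
  have "is_open (U \<inter> V)" if U: "is_open U" and V: "is_open V" for U V
  proof (rule is_openI)
    show "U \<inter> V \<subseteq> points" using U by (auto simp: is_open_def)
    fix g assume g: "lim g \<in> U \<inter> V"
    have "{n \<in> G g. pt n \<notin> U \<inter> V} = {n \<in> G g. pt n \<notin> U} \<union> {n \<in> G g. pt n \<notin> V}" by auto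
    then show "finite {n \<in> G g. pt n \<notin> U \<inter> V}" using U V g by (auto simp: is_open_def)
  next
    assume "om \<in> U \<inter> V"
    then have "om \<in> U" "om \<in> V" by auto
    obtain H1 where H1: "finite H1" "\<forall>g. g \<notin> H1 \<longrightarrow> lim g \<in> U" "finite {n. pt n \<notin> U \<and> n \<notin> \<Union> (G ` H1)}"
      using U \<open>om \<in> U\<close> unfolding is_open_def by blast
    obtain H2 where H2: "finite H2" "\<forall>g. g \<notin> H2 \<longrightarrow> lim g \<in> V" "finite {n. pt n \<notin> V \<and> n \<notin> \<Union> (G ` H2)}"
      using V \<open>om \<in> V\<close> unfolding is_open_def by blast
    note H = H1 H2
    have "{n. pt n \<notin> U \<inter> V \<and> n \<notin> \<Union> (G ` (H1 \<union> H2))} \<subseteq>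
        {n. pt n \<notin> U \<and> n \<notin> \<Union> (G ` H1)} \<union> {n. pt n \<notin> V \<and> n \<notin> \<Union> (G ` H2)}" by auto
    then have "finite {n. pt n \<notin> U \<inter> V \<and> n \<notin> \<Union> (G ` (H1 \<union> H2))}"
      by (rule finite_subset) (use H in simp)
    then show "\<exists>H. finite H \<and> (\<forall>g. g \<notin> H \<longrightarrow> lim g \<in> U \<inter> V) \<and> finite {n. pt n \<notin> U \<inter> V \<and> n \<notin> \<Union> (G ` H)}"
      using H by (intro exI[of _ "H1 \<union> H2"]) auto
  qed
  moreover have "is_open (\<Union>\<K>)" if K: "\<forall>U\<in>\<K>. is_open U" for \<K>
  proof (rule is_openI)
    show "\<Union>\<K> \<subseteq> points" using K by (auto simp: is_open_def)
    fix g assume "lim g \<in> \<Union>\<K>"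
    then obtain U where U: "U \<in> \<K>" "lim g \<in> U" by blast
    then have "finite {n \<in> G g. pt n \<notin> U}" using K by (auto simp: is_open_def)
    then show "finite {n \<in> G g. pt n \<notin> \<Union>\<K>}" by (rule rev_finite_subset) (use U in auto)
  next
    assume "om \<in> \<Union>\<K>"
    then obtain U where U: "U \<in> \<K>" "om \<in> U" by blast
    then have "is_open U" using K by blast
    then obtain H where H: "finite H" "\<forall>g. g \<notin> H \<longrightarrow> lim g \<in> U" "finite {n. pt n \<notin> U \<and> n \<notin> \<Union> (G ` H)}"
      using U unfolding is_open_def by blast
    from H(3) have "finite {n. pt n \<notin> \<Union>\<K> \<and> n \<notin> \<Union> (G ` H)}" by (rule rev_finite_subset) (use U in auto)
    then show "\<exists>H. finite H \<and> (\<forall>g. g \<notin> H \<longrightarrow> lim g \<in> \<Union>\<K>) \<and> finite {n. pt n \<notin> \<Union>\<K> \<and> n \<notin> \<Union> (G ` H)}"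
      using H U by blast
  qed
  ultimately have "istopology is_open" by (auto simp: istopology_def)
  then show ?thesis by (simp add: psi_def)
qed

lemma topspace_psi: "topspace psi = points"
proof
  show "topspace psi \<subseteq> points" using openin_psi[of "topspace psi"] by (auto simp: is_open_def)
  have "is_open points"
    by (rule is_openI) (auto simp: points_def intro: exI[of _ "{}"])
  then show "points \<subseteq> topspace psi" by (simp add: openin_psi openin_subset)
qed

lemma points_cases:
  assumes "x \<in> points"
  obtains n where "x = pt n" | g where "x = lim g" | "x = om"
  using assms by (auto simp: points_def)

lemma points_intros [simp]: "pt n \<in> points" "lim g \<in> points" "om \<in> points"
  by (auto simp: points_def)

lemmas distinct_simps [simp] =
  distinct distinct[symmetric] inj_eq[OF inj_pt] inj_eq[OF inj_lim]

lemma openin_pt: "openin psi {pt n}"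
  unfolding openin_psi by (rule is_openI) auto

definition nbhd :: "'g \<Rightarrow> 'a set" where
  "nbhd g = insert (lim g) (pt ` G g)"

lemma nbhd_simps [simp]: "pt n \<in> nbhd g \<longleftrightarrow> n \<in> G g" "lim h \<in> nbhd g \<longleftrightarrow> h = g" "om \<notin> nbhd g"
  by (auto simp: nbhd_def)

lemma openin_nbhd: "openin psi (nbhd g)"
  unfolding openin_psi
proof (rule is_openI)
  show "nbhd g \<subseteq> points" by (auto simp: nbhd_def)
qed auto

lemma closedin_pt: "closedin psi {pt n}"
  unfolding closedin_def openin_psi topspace_psi
proof (intro conjI is_openI)
  show "\<exists>H. finite H \<and> (\<forall>g. g \<notin> H \<longrightarrow> lim g \<in> points - {pt n}) \<and>
      finite {m. pt m \<notin> points - {pt n} \<and> m \<notin> \<Union> (G ` H)}"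
    by (rule exI[of _ "{}"]) auto
qed auto

lemma closedin_nbhd: "closedin psi (nbhd g)"
  unfolding closedin_def openin_psi topspace_psi
proof (intro conjI is_openI)
  show "nbhd g \<subseteq> points" by (auto simp: nbhd_def)
  show "\<exists>H. finite H \<and> (\<forall>h. h \<notin> H \<longrightarrow> lim h \<in> points - nbhd g) \<and>
      finite {m. pt m \<notin> points - nbhd g \<and> m \<notin> \<Union> (G ` H)}"
    by (rule exI[of _ "{g}"]) auto
  fix h assume "lim h \<in> points - nbhd g"
  then have "h \<noteq> g" by auto
  moreover have "{n \<in> G h. pt n \<notin> points - nbhd g} = G h \<inter> G g" by auto
  ultimately show "finite {n \<in> G h. pt n \<notin> points - nbhd g}" using almost_disjoint by simp
qed auto

text \<open>Clopen sets suffice: one of two distinct points differs from \<open>om\<close>, and an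
  isolated point or some \<open>nbhd g\<close> tells them apart.\<close>

lemma Hausdorff_psi: "Hausdorff_space psi"
  unfolding Hausdorff_space_def
proof (intro allI impI)
  fix x y assume xy: "x \<in> topspace psi \<and> y \<in> topspace psi \<and> x \<noteq> y"
  have "\<exists>C. openin psi C \<and> closedin psi C \<and> (x \<in> C) \<noteq> (y \<in> C)"
  proof (cases "(\<exists>n. x = pt n) \<or> (\<exists>n. y = pt n)")
    case True
    then obtain n where "x = pt n \<or> y = pt n" by blast
    then show ?thesis using openin_pt[of n] closedin_pt[of n] xy by (intro exI[of _ "{pt n}"]) auto
  next
    case False
    then obtain g where "x = lim g \<or> y = lim g"
      using xy unfolding topspace_psi by (metis points_cases)
    then show ?thesis using False openin_nbhd[of g] closedin_nbhd[of g] xy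
      by (intro exI[of _ "nbhd g"]) (auto simp: nbhd_def)
  qed
  then obtain C where C: "openin psi C" "closedin psi C" "(x \<in> C) \<noteq> (y \<in> C)" by blast
  then have D: "openin psi (topspace psi - C)" "disjnt C (topspace psi - C)" "disjnt (topspace psi - C) C"
    by (auto simp: closedin_def disjnt_def)
  show "\<exists>U V. openin psi U \<and> openin psi V \<and> x \<in> U \<and> y \<in> V \<and> disjnt U V"
    using C D xy by (cases "x \<in> C") blast+
qed

text \<open>A member of the cover around \<open>om\<close> misses finitely many limits; adding
  members around these leaves only the finite set \<open>R\<close> of isolated points.\<close>

lemma compact_psi: "compact_space psi"
  unfolding compact_space_def compactin_def
proof (intro conjI allI impI)
  fix \<U> assume U: "(\<forall>U\<in>\<U>. openin psi U) \<and> topspace psi \<subseteq> \<Union>\<U>"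
  then have cov: "\<exists>U\<in>\<U>. x \<in> U" if "x \<in> points" for x using that by (auto simp: topspace_psi)
  then obtain c where c: "\<And>x. x \<in> points \<Longrightarrow> c x \<in> \<U> \<and> x \<in> c x" by metis
  then have op: "is_open (c x)" if "x \<in> points" for x using that U openin_psi by blast
  obtain H where H: "finite H" "\<And>g. g \<notin> H \<Longrightarrow> lim g \<in> c om" "finite {n. pt n \<notin> c om \<and> n \<notin> \<Union> (G ` H)}"
    using op[of om] c[of om] unfolding is_open_def by (metis points_intros(3))
  define R where "R = {n. pt n \<notin> c om \<and> n \<notin> \<Union> (G ` H)} \<union> (\<Union>g\<in>H. {n \<in> G g. pt n \<notin> c (lim g)})"
  have "finite {n \<in> G g. pt n \<notin> c (lim g)}" for g
    using op[of "lim g"] c[of "lim g"] unfolding is_open_def by simp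
  then have R: "finite R" using H by (auto simp: R_def)
  have "topspace psi \<subseteq> \<Union> (c ` ({om} \<union> lim ` H \<union> pt ` R))"
  proof
    fix x assume "x \<in> topspace psi"
    then have "x \<in> points" by (simp add: topspace_psi)
    then show "x \<in> \<Union> (c ` ({om} \<union> lim ` H \<union> pt ` R))"
    proof (cases rule: points_cases)
      case (1 n)
      then show ?thesis using c[of x] \<open>x \<in> points\<close> by (auto simp: R_def)
    next
      case (2 g)
      then show ?thesis using c[of "lim g"] H(2)[of g] by (cases "g \<in> H") auto
    next
      case 3
      then show ?thesis using c[of om] by auto
    qed
  qed
  moreover have "c ` ({om} \<union> lim ` H \<union> pt ` R) \<subseteq> \<U>" using c by auto
  moreover have "finite (c ` ({om} \<union> lim ` H \<union> pt ` R))" using H R by auto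
  ultimately show "\<exists>\<F>. finite \<F> \<and> \<F> \<subseteq> \<U> \<and> topspace psi \<subseteq> \<Union>\<F>" by blast
qed auto

lemma separable_psi: "separable_space psi"
  unfolding separable_space_def
proof (intro exI conjI)
  let ?C = "insert om (range pt)"
  show "countable ?C" by simp
  show "?C \<subseteq> topspace psi" by (auto simp: topspace_psi)
  show "psi closure_of ?C = topspace psi"
    unfolding dense_intersects_open
  proof (intro allI impI)
    fix T assume T: "openin psi T \<and> T \<noteq> {}"
    then have T': "is_open T" by (simp add: openin_psi)
    obtain x where x: "x \<in> T" using T by blast
    then have "x \<in> points" using T' by (auto simp: is_open_def)
    then show "?C \<inter> T \<noteq> {}"
    proof (cases rule: points_cases)
      case (2 g)
      then have "finite {n \<in> G g. pt n \<notin> T}" using T' x by (auto simp: is_open_def)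
      then have "infinite (G g - {n \<in> G g. pt n \<notin> T})"
        using infinite_G Diff_infinite_finite by blast
      then have "G g - {n \<in> G g. pt n \<notin> T} \<noteq> {}" by (metis finite.emptyI)
      then obtain n where "n \<in> G g - {n \<in> G g. pt n \<notin> T}" by blast
      then show ?thesis by auto
    qed (use x in auto)
  qed
qed

lemma scattered_psi: "scattered_space psi"
  unfolding scattered_space_def
proof (intro allI impI)
  fix A assume A: "A \<subseteq> topspace psi \<and> A \<noteq> {}"
  consider n where "pt n \<in> A" | g where "lim g \<in> A" "range pt \<inter> A = {}" | "A = {om}"
    using A unfolding topspace_psi points_def by blast
  then show "\<exists>x\<in>A. openin (subtopology psi A) {x}"
  proof cases
    case (1 n)
    then have "{pt n} = {pt n} \<inter> A" by auto
    then show ?thesis using 1 openin_pt[of n] by (metis openin_subtopology)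
  next
    case (2 g)
    then have "{lim g} = nbhd g \<inter> A" by (auto simp: nbhd_def)
    then show ?thesis using 2 openin_nbhd[of g] by (metis openin_subtopology)
  next
    case 3
    then have "{om} = topspace psi \<inter> A" by (auto simp: topspace_psi)
    then show ?thesis using 3 by (metis openin_subtopology openin_topspace singletonI)
  qed
qed

text \<open>The first derivative loses the isolated points \<open>pt n\<close>, the second the
  limits, and the third whatever remains of \<open>om\<close>.\<close>

lemma derivative3_psi: "topspace ((derivative ^^ 3) psi) = {}"
proof -
  define X1 where "X1 = derivative psi"
  define X2 where "X2 = derivative X1"
  have X1: "topspace X1 \<subseteq> range lim \<union> {om}"
    using openin_pt by (auto simp: X1_def topspace_derivative topspace_psi points_def)
  have "x = om" if "x \<in> topspace X2" for x
  proof (rule ccontr)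
    assume "x \<noteq> om"
    have x: "x \<in> topspace X1" "\<not> openin X1 {x}" using that by (auto simp: X2_def topspace_derivative)
    then obtain g where g: "x = lim g" using X1 \<open>x \<noteq> om\<close> by auto
    have "{x} = nbhd g \<inter> topspace X1" using X1 x g by (auto simp: nbhd_def)
    moreover have "openin X1 (nbhd g \<inter> topspace X1)"
      using openin_nbhd[of g] unfolding X1_def derivative_def openin_subtopology by auto
    ultimately show False using x by simp
  qed
  then have "topspace X2 \<subseteq> {om}" by auto
  then have "openin X2 {x}" if "x \<in> topspace X2" for x
    using that openin_topspace[of X2] by (metis singletonD subset_singletonD empty_iff)
  then have "topspace (derivative X2) = {}" by (auto simp: topspace_derivative)
  then show ?thesis by (simp add: X2_def X1_def numeral_3_eq_3)
qed

lemma finite_lim_ge: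
  assumes f: "continuous_map psi euclideanreal f" and r: "r > 0" and 0: "f om = 0"
  shows "finite {g. \<bar>f (lim g)\<bar> \<ge> r}"
proof -
  have "openin psi {x \<in> topspace psi. f x \<in> {-r<..<r}}"
    using f by (auto simp: continuous_map_def)
  moreover have "om \<in> {x \<in> topspace psi. f x \<in> {-r<..<r}}" using r 0 by (simp add: topspace_psi)
  ultimately obtain H where H: "finite H" "\<forall>g. g \<notin> H \<longrightarrow> lim g \<in> {x \<in> topspace psi. f x \<in> {-r<..<r}}"
    unfolding openin_psi is_open_def by blast
  have "{g. \<bar>f (lim g)\<bar> \<ge> r} \<subseteq> H"
  proof
    fix g assume "g \<in> {g. \<bar>f (lim g)\<bar> \<ge> r}"
    then show "g \<in> H" using H(2) by (cases "g \<in> H") auto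
  qed
  then show ?thesis using H(1) by (rule finite_subset)
qed

text \<open>The set where \<open>f\<close> is smaller than \<open>r\<close> in absolute value is
  open and contains \<open>om\<close> and all limits. It misses finitely many points off a finite
  union of sets \<open>G g\<close>, and finitely many in each of these.\<close>

lemma finite_pt_ge:
  assumes f: "continuous_map psi euclideanreal f" and r: "r > 0" and 0: "f om = 0"
    and lim: "\<And>g. \<bar>f (lim g)\<bar> < r"
  shows "finite {n. \<bar>f (pt n)\<bar> \<ge> r}"
proof -
  define U where "U = {x \<in> topspace psi. f x \<in> {-r<..<r}}"
  have op: "is_open U"
    unfolding U_def using f by (auto simp: continuous_map_def simp flip: openin_psi)
  have U: "pt n \<notin> U \<longleftrightarrow> \<bar>f (pt n)\<bar> \<ge> r" "lim g \<in> U" "om \<in> U" for n g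
    using lim[of g] r 0 by (auto simp: U_def topspace_psi)
  obtain H where H: "finite H" "finite {n. pt n \<notin> U \<and> n \<notin> \<Union> (G ` H)}"
    using op U(3) unfolding is_open_def by blast
  have "finite {n \<in> G g. pt n \<notin> U}" for g using op U(2) by (auto simp: is_open_def)
  then have "finite ({n. pt n \<notin> U \<and> n \<notin> \<Union> (G ` H)} \<union> (\<Union>g\<in>H. {n \<in> G g. pt n \<notin> U}))"
    using H by auto
  then show ?thesis by (rule rev_finite_subset) (auto simp: U(1))
qed

end

section \<open>Eigenspaces of an isometric involution\<close>

locale isometric_involution =
  fixes E :: "'a::real_normed_vector set" and R :: "'a \<Rightarrow> 'a"
  assumes E: "subspace E" "closed E" and R_lin: "linear R"
    and R_in: "\<And>x. x \<in> E \<Longrightarrow> R x \<in> E" and R_inv: "\<And>x. x \<in> E \<Longrightarrow> R (R x) = x"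
    and R_norm: "\<And>x. norm (R x) \<le> norm x"
begin

definition eigen :: "real \<Rightarrow> 'a set" where
  "eigen s = {x \<in> E. R x = s *\<^sub>R x}"

definition proj :: "real \<Rightarrow> 'a \<Rightarrow> 'a" where
  "proj s x = (1/2) *\<^sub>R (x + s *\<^sub>R R x)"

lemma bounded_linear_R: "bounded_linear R"
  using R_norm by (intro bounded_linear_intro[where K = 1]) (auto simp: linear_add[OF R_lin] linear_scale[OF R_lin])

lemma linear_proj: "linear (proj s)"
  by (rule linearI) (simp_all add: proj_def linear_add[OF R_lin] linear_scale[OF R_lin] algebra_simps)

lemma continuous_proj: "continuous_on A (proj s)"
  unfolding proj_def
  by (intro continuous_intros linear_continuous_on bounded_linear_R)

lemma subspace_eigen: "subspace (eigen s)"
  using E(1) unfolding eigen_def subspace_def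
  by (auto simp: linear_0[OF R_lin] linear_add[OF R_lin] linear_scale[OF R_lin] scaleR_add_right mult.commute)

lemma closed_eigen: "closed (eigen s)"
proof -
  have "eigen s = E \<inter> {x. R x = s *\<^sub>R x}" by (auto simp: eigen_def)
  moreover have "closed {x. R x = s *\<^sub>R x}"
    by (intro closed_Collect_eq continuous_intros linear_continuous_on bounded_linear_R)
  ultimately show ?thesis using E(2) by auto
qed

lemma proj_eigen:
  assumes "x \<in> eigen s" "s \<in> {1, -1}"
  shows "proj s x = x"
  using assms by (auto simp: proj_def eigen_def simp flip: scaleR_2)

lemma proj_in:
  assumes x: "x \<in> E" and s: "s \<in> {1, -1}"
  shows "proj s x \<in> eigen s"
proof -
  have "proj s x \<in> E"
    unfolding proj_def using E(1) x R_in by (intro subspace_scale subspace_add) auto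
  moreover have "R (proj s x) = s *\<^sub>R proj s x"
    using s by (auto simp: proj_def linear_add[OF R_lin] linear_scale[OF R_lin] linear_diff[OF R_lin] R_inv[OF x] algebra_simps)
  ultimately show ?thesis by (simp add: eigen_def)
qed

lemma norm_proj_le:
  assumes "s \<in> {1, -1}"
  shows "norm (proj s x) \<le> norm x"
proof -
  have "norm (x + s *\<^sub>R R x) \<le> norm x + norm (s *\<^sub>R R x)" by (rule norm_triangle_ineq)
  also have "norm (s *\<^sub>R R x) \<le> norm x" using assms R_norm by auto
  finally show ?thesis by (simp add: proj_def)
qed

text \<open>Averaging with \<open>R\<close> does not increase norms; the fixed nonzero vector
  \<open>z\<close> makes the operator norm exactly one, whereas the zero space would give 0.\<close>

lemma one_complemented_eigen:
  assumes s: "s \<in> {1, -1}" and ne: "z \<in> eigen s" "z \<noteq> 0"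
  shows "one_complemented (eigen s) E"
  unfolding one_complemented_def
proof (intro conjI exI[of _ "proj s"])
  show "eigen s \<subseteq> E" by (auto simp: eigen_def)
  show "proj s ` E = eigen s"
  proof
    show "proj s ` E \<subseteq> eigen s" using proj_in[OF _ s] by blast
    show "eigen s \<subseteq> proj s ` E"
      using proj_eigen[OF _ s] by (metis (no_types, lifting) eigen_def image_eqI mem_Collect_eq subsetI)
  qed
  show "\<forall>x\<in>E. proj s (proj s x) = proj s x" using proj_eigen[OF proj_in[OF _ s] s] by blast
  have le: "norm (proj s x) / norm x \<le> 1" for x
    using norm_proj_le[OF s, of x] by (cases "x = 0") (auto simp: divide_le_eq_1)
  then show bdd: "bdd_above ((\<lambda>x. norm (proj s x) / norm x) ` E)" by (intro bdd_aboveI2)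
  show "(SUP x\<in>E. norm (proj s x) / norm x) = 1"
  proof (rule cSup_eq_maximum)
    have "norm (proj s z) / norm z = 1" using proj_eigen[OF ne(1) s] ne(2) by simp
    moreover have "z \<in> E" using ne by (simp add: eigen_def)
    ultimately show "1 \<in> (\<lambda>x. norm (proj s x) / norm x) ` E"
      by (intro image_eqI[of _ _ z]) auto
  qed (use le in auto)
qed (rule subspace_eigen closed_eigen linear_proj)+

text \<open>The even and odd parts add up to the vector, and each projection annihilates the other
  eigenspace.\<close>

lemma banach_isomorphic_eigen_sum: "banach_isomorphic E (eigen 1 \<times> eigen (-1))"
  unfolding banach_isomorphic_def
proof (intro exI conjI)
  show "linear (\<lambda>x. (proj 1 x, proj (-1) x))"
    by (rule linearI) (simp_all add: linear_add[OF linear_proj] linear_scale[OF linear_proj])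
  have sum: "proj 1 x + proj (-1) x = x" for x
    by (simp add: proj_def algebra_simps flip: scaleR_2)
  have cross: "proj s x = 0" if "x \<in> eigen (- s)" "s \<in> {1, -1}" for s x
    using that by (auto simp: proj_def eigen_def)
  show "homeomorphism E (eigen 1 \<times> eigen (-1)) (\<lambda>x. (proj 1 x, proj (-1) x)) (\<lambda>(a, b). a + b)"
  proof (rule homeomorphismI)
    show "continuous_on E (\<lambda>x. (proj 1 x, proj (-1) x))"
      by (intro continuous_on_Pair continuous_proj)
    show "continuous_on (eigen 1 \<times> eigen (-1)) (\<lambda>(a, b). a + b)"
      unfolding split_beta by (intro continuous_intros)
    show "(\<lambda>(a, b). a + b) ` (eigen 1 \<times> eigen (-1)) \<subseteq> E"
      using subspace_add[OF E(1)] by (auto simp: eigen_def)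
    show "(\<lambda>x. (proj 1 x, proj (-1) x)) ` E \<subseteq> eigen 1 \<times> eigen (-1)" using proj_in by auto
    show "(case (proj 1 x, proj (-1) x) of (a, b) \<Rightarrow> a + b) = x" for x using sum by simp
    show "(proj 1 (case p of (a, b) \<Rightarrow> a + b), proj (-1) (case p of (a, b) \<Rightarrow> a + b)) = p"
      if p: "p \<in> eigen 1 \<times> eigen (-1)" for p
    proof (cases p)
      case (Pair a b)
      then have "a \<in> eigen 1" "b \<in> eigen (-1)" using p by auto
      then show ?thesis
        using proj_eigen[of a 1] proj_eigen[of b "-1"] cross[of a "-1"] cross[of b 1]
        by (simp add: Pair linear_add[OF linear_proj])
    qed
  qed
qed

end

section \<open>A criterion for not being a \<open>C\<close>-space\<close>

text \<open>Homogeneity in place of linearity suits the inverse of a linear homeomorphism. Vectors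
  are rescaled into a ball where continuity at 0 bounds \<open>h\<close> by 1.\<close>

lemma homogeneous_continuous_bounded:
  assumes V: "subspace V" and cont: "continuous_on V h"
    and hom: "\<And>c x. x \<in> V \<Longrightarrow> h (c *\<^sub>R x) = c *\<^sub>R h x"
  obtains B where "B > 0" "\<And>x. x \<in> V \<Longrightarrow> norm (h x) \<le> B * norm x"
proof -
  have h0: "h 0 = 0" using hom[of 0 0] subspace_0[OF V] by simp
  obtain d where d: "d > 0" "\<And>x. x \<in> V \<Longrightarrow> norm x < d \<Longrightarrow> norm (h x) < 1"
    using cont[unfolded continuous_on_iff, rule_format, of 0 1] subspace_0[OF V] h0 by auto
  have "norm (h x) \<le> 2 / d * norm x" if "x \<in> V" for x
  proof (cases "x = 0")
    case False
    define c where "c = d / (2 * norm x)"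
    have c: "c > 0" using d False by (simp add: c_def)
    have "norm (c *\<^sub>R x) < d" using False d by (simp add: c_def)
    then have "norm (h (c *\<^sub>R x)) < 1" using d(2) subspace_scale[OF V that] by blast
    then have "c * norm (h x) < 1" using hom[OF that] c by simp
    then show ?thesis using c False d by (simp add: c_def field_simps)
  qed (use h0 in simp)
  then show thesis using that[of "2 / d"] d by simp
qed

text \<open>If \<open>f\<close> is an isomorphism onto \<open>C(S)\<close>, choose points \<open>p m\<close> of \<open>S\<close> where \<open>f (e m)\<close> is large and let
  \<open>\<phi> m\<close> be the scaled evaluations of \<open>f\<close> there. The index \<open>u\<close> is adversarial to the matrix
  \<open>\<phi> m (e k)\<close>, corrected by the singular parts \<open>\<psi>\<close> of the \<open>\<phi> m\<close>. The element \<open>y\<close> of \<open>X\<close> with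
  \<open>f y = \<bar>f x'\<bar>\<close>, for a tail \<open>x'\<close> of \<open>x u\<close>, then yields a combination of the other \<open>x w\<close> that separates.\<close>

theorem not_C_space_criterion:
  fixes X :: "'a::real_normed_vector set" and e :: "nat \<Rightarrow> 'a" and x :: "nat set \<Rightarrow> 'a"
  assumes X: "subspace X" and e: "\<And>k. e k \<in> X" and x: "\<And>u. x u \<in> X"
    and v: "\<And>u k. v u k \<in> {-1, 0, 1 :: real}"
    and adv: "\<And>M M' B B' C. rows_bounded B M \<Longrightarrow> (\<And>m j. \<bar>M' m j\<bar> \<le> B') \<Longrightarrow> countable C \<Longrightarrow>
       \<exists>u A. u \<notin> C \<and> tame A M M' \<and> (\<forall>k. v u k \<noteq> 0 \<longrightarrow> k \<in> A) \<and>
         (\<forall>F c s. finite F \<longrightarrow> u \<notin> F \<longrightarrow> (\<forall>w\<in>F. c w \<in> \<rat>) \<longrightarrow> s \<in> {1, -1} \<longrightarrow>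
            \<not> separates (mat_app M (\<lambda>k. \<Sum>w\<in>F. c w * v w k)) A (v u) s (1/2))"
    and e_norm: "\<And>k. norm (e k) \<ge> 1"
    and e_sum: "\<And>D c. finite D \<Longrightarrow> (\<And>k. \<bar>c k\<bar> \<le> 1) \<Longrightarrow> norm (\<Sum>k\<in>D. c k *\<^sub>R e k) \<le> 1"
    and x_sum: "\<And>F c. finite F \<Longrightarrow> (\<And>u. \<bar>c u\<bar> \<le> 1) \<Longrightarrow>
       \<exists>N. \<forall>n\<ge>N. norm (\<Sum>u\<in>F. c u *\<^sub>R (x u - (\<Sum>k<n. v u k *\<^sub>R e k))) \<le> 1"
    and dense: "\<And>y r. y \<in> X \<Longrightarrow> r > 0 \<Longrightarrow> \<exists>F c D d. finite F \<and> finite D \<and>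
       (\<forall>u\<in>F. c u \<in> \<rat> \<and> \<bar>c u\<bar> \<le> norm y + r) \<and>
       norm (y - ((\<Sum>u\<in>F. c u *\<^sub>R x u) + (\<Sum>k\<in>D. d k *\<^sub>R e k))) \<le> r"
  shows "\<not> is_C_space X"
proof
  assume "is_C_space X"
  then obtain S :: "('a \<Rightarrow> real) topology" and f g where S: "compact_space S" "Hausdorff_space S"
    and f: "linear f" and fg: "homeomorphism X (cspace S) f g"
    by (auto simp: is_C_space_def banach_isomorphic_def)
  have fX: "f y \<in> cspace S" if "y \<in> X" for y using fg that by (auto simp: homeomorphism_def)
  have gX: "g w \<in> X" if "w \<in> cspace S" for w using fg that by (auto simp: homeomorphism_def)
  have gf: "g (f y) = y" if "y \<in> X" for y using fg that by (auto simp: homeomorphism_def)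
  have fg': "f (g w) = w" if "w \<in> cspace S" for w using fg that by (auto simp: homeomorphism_def)
  obtain Q where Q: "Q > 0" "\<And>y. y \<in> X \<Longrightarrow> norm (f y) \<le> Q * norm y"
    using homogeneous_continuous_bounded[OF X, of f] fg linear_scale[OF f]
    by (auto simp: homeomorphism_def)
  have "g (c *\<^sub>R w) = c *\<^sub>R g w" if "w \<in> cspace S" for c w
    using gf[OF subspace_scale[OF X gX[OF that], of c]] fg'[OF that] by (simp add: linear_scale[OF f])
  then obtain q where q: "q > 0" "\<And>w. w \<in> cspace S \<Longrightarrow> norm (g w) \<le> q * norm w"
    using homogeneous_continuous_bounded[OF subspace_cspace, of S g] fg
    by (auto simp: homeomorphism_def)
  \<comment> \<open>If \<open>f (e k)\<close> were below \<open>1 / (2 * q)\<close> everywhere, then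
    \<open>e k = g (f (e k))\<close> would have norm at most \<open>1/2\<close>.\<close>
  have "\<exists>p. 1 \<le> 2 * q * \<bar>apply_bcontfun (f (e k)) p\<bar>" for k
  proof (rule ccontr)
    assume "\<nexists>p. 1 \<le> 2 * q * \<bar>apply_bcontfun (f (e k)) p\<bar>"
    then have "norm (apply_bcontfun (f (e k)) p) \<le> 1 / (2 * q)" for p
      using q(1) by (simp add: field_simps not_le) (meson less_imp_le)
    then have "norm (f (e k)) \<le> 1 / (2 * q)" by (rule norm_bound)
    then have "q * norm (f (e k)) \<le> q * (1 / (2 * q))" using q(1) by (intro mult_left_mono) auto
    then have "norm (e k) \<le> 1/2"
      using q(2)[OF fX[OF e[of k]]] gf[OF e[of k]] q(1) by simp
    then show False using e_norm[of k] by simp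
  qed
  then obtain p where p: "\<And>k. 1 \<le> 2 * q * \<bar>apply_bcontfun (f (e k)) (p k)\<bar>" by metis
  \<comment> \<open>The factor \<open>2 * q\<close> makes the diagonal entries of the matrix at
    least 1 in absolute value.\<close>
  define \<phi> where "\<phi> = (\<lambda>m y. 2 * q * apply_bcontfun (f y) (p m))"
  define P where "P = 2 * q * Q"
  have P: "P > 0" using q Q by (simp add: P_def)
  have \<phi>_lin: "linear (\<phi> m)" for m
    unfolding \<phi>_def by (rule linearI) (simp_all add: linear_add[OF f] linear_scale[OF f] algebra_simps)
  have \<phi>_le: "\<bar>\<phi> m y\<bar> \<le> P * norm y" if "y \<in> X" for m y
  proof -
    have "\<bar>apply_bcontfun (f y) (p m)\<bar> \<le> Q * norm y"
      using norm_bounded[of "f y" "p m"] Q(2)[OF that] by simp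
    then show ?thesis using q(1) by (simp add: \<phi>_def P_def abs_mult)
  qed
  define M where "M = (\<lambda>m k. \<phi> m (e k))"
  have M1: "1 \<le> \<bar>M m m\<bar>" for m using p[of m] q(1) by (simp add: M_def \<phi>_def abs_mult)
  have sumX: "(\<Sum>k\<in>D. c k *\<^sub>R e k) \<in> X" for D and c :: "nat \<Rightarrow> real"
    by (intro subspace_sum X subspace_scale e)
  have \<phi>_sum_e: "\<phi> m (\<Sum>k\<in>D. c k *\<^sub>R e k) = (\<Sum>k\<in>D. M m k * c k)" for m D c
    by (simp add: M_def linear_sum[OF \<phi>_lin] linear_scale[OF \<phi>_lin] mult.commute)
  have M: "rows_bounded P M"
    unfolding rows_bounded_def
  proof (intro allI impI)
    fix m and D :: "nat set" assume D: "finite D"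
    have "(\<Sum>k\<in>D. \<bar>M m k\<bar>) = \<phi> m (\<Sum>k\<in>D. sgn (M m k) *\<^sub>R e k)"
      unfolding \<phi>_sum_e by (simp add: abs_sgn)
    also have "\<dots> \<le> P * norm (\<Sum>k\<in>D. sgn (M m k) *\<^sub>R e k)"
      using \<phi>_le[OF sumX] by (meson abs_le_D1)
    also have "\<dots> \<le> P * 1"
      using P by (intro mult_left_mono e_sum D) (auto simp: abs_sgn_eq)
    finally show "(\<Sum>k\<in>D. \<bar>M m k\<bar>) \<le> P" by simp
  qed
  have v1: "\<bar>v u k\<bar> \<le> 1" for u k using v[of u k] by auto
  \<comment> \<open>The singular part is what \<open>\<phi> m\<close> sees of \<open>x u\<close>
    beyond the coordinates \<open>v u\<close>. It survives on every tail of \<open>x u\<close>, and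
    signed sums of far tails have norm at most 1, which bounds its l1 norm.\<close>
  define \<psi> where "\<psi> = (\<lambda>m u. \<phi> m (x u) - mat_app M (v u) m)"
  have \<psi>_sum: "(\<Sum>u\<in>F. \<bar>\<psi> m u\<bar>) \<le> P" if F: "finite F" for m F
  proof -
    define c where "c = (\<lambda>u. sgn (\<psi> m u))"
    have c: "\<bar>c u\<bar> \<le> 1" for u by (simp add: c_def abs_sgn_eq)
    obtain N where N: "\<And>n. n \<ge> N \<Longrightarrow> norm (\<Sum>u\<in>F. c u *\<^sub>R (x u - (\<Sum>k<n. v u k *\<^sub>R e k))) \<le> 1"
      using x_sum[OF F, of c, OF c] by blast
    have "(\<lambda>n. \<Sum>k<n. M m k * v u k) \<longlonglongrightarrow> mat_app M (v u) m" for u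
      unfolding mat_app_def using mat_app_summable(2)[OF M v1] by (rule summable_LIMSEQ)
    then have "(\<lambda>n. \<Sum>u\<in>F. c u * (\<phi> m (x u) - (\<Sum>k<n. M m k * v u k))) \<longlonglongrightarrow> (\<Sum>u\<in>F. c u * \<psi> m u)"
      unfolding \<psi>_def by (intro tendsto_intros)
    moreover have "(\<Sum>u\<in>F. c u * (\<phi> m (x u) - (\<Sum>k<n. M m k * v u k))) \<le> P" if "n \<ge> N" for n
    proof -
      let ?y = "\<Sum>u\<in>F. c u *\<^sub>R (x u - (\<Sum>k<n. v u k *\<^sub>R e k))"
      have "?y \<in> X" by (intro subspace_sum X subspace_scale subspace_diff x sumX)
      then have "\<phi> m ?y \<le> P * norm ?y" using \<phi>_le by (meson abs_le_D1)
      also have "\<dots> \<le> P * 1" using N[OF that] P by (intro mult_left_mono) auto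
      finally show ?thesis
        by (simp add: linear_sum[OF \<phi>_lin] linear_scale[OF \<phi>_lin] linear_diff[OF \<phi>_lin] M_def mult.commute)
    qed
    ultimately have "(\<Sum>u\<in>F. c u * \<psi> m u) \<le> P" by (intro LIMSEQ_le_const2) auto
    then show ?thesis by (simp add: c_def abs_sgn mult.commute)
  qed
  \<comment> \<open>For each \<open>m\<close> only countably many singular parts are nonzero. An
    index outside \<open>C\<close> has none, so there \<open>\<phi> m (x u)\<close> equals
    \<open>mat_app M (v u) m\<close>.\<close>
  define C where "C = (\<Union>m. {u \<in> UNIV. \<psi> m u \<noteq> 0})"
  have C: "countable C"
    unfolding C_def
  proof (intro countable_UN countableI_type)
    fix m
    have "(\<lambda>u. \<bar>\<psi> m u\<bar>) summable_on UNIV"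
      using \<psi>_sum by (intro nonneg_bdd_above_summable_on) (auto intro!: bdd_aboveI2)
    then have "countable {u \<in> UNIV. \<bar>\<psi> m u\<bar> \<noteq> 0}" by (rule summable_countable_real)
    then show "countable {u \<in> UNIV. \<psi> m u \<noteq> 0}" by simp
  qed
  \<comment> \<open>The singular parts become columns of the second matrix, which tameness makes
    convergent along \<open>A\<close>; the inserted \<open>{}\<close> keeps the enumerated set
    nonempty.\<close>
  define \<eta> where "\<eta> = from_nat_into (insert {} C)"
  have \<eta>: "C \<subseteq> range \<eta>" using C by (auto simp: \<eta>_def range_from_nat_into)
  have \<psi>_le: "\<bar>\<psi> m (\<eta> j)\<bar> \<le> P" for m j using \<psi>_sum[of "{\<eta> j}" m] by simp
  obtain u A where u: "u \<notin> C" and tame: "tame A M (\<lambda>m j. \<psi> m (\<eta> j))"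
    and vA: "\<And>k. v u k \<noteq> 0 \<Longrightarrow> k \<in> A"
    and nonsep: "\<And>F c s. finite F \<Longrightarrow> u \<notin> F \<Longrightarrow> (\<forall>w\<in>F. c w \<in> \<rat>) \<Longrightarrow> s \<in> {1, -1} \<Longrightarrow>
            \<not> separates (mat_app M (\<lambda>k. \<Sum>w\<in>F. c w * v w k)) A (v u) s (1/2)"
    using adv[of P M "\<lambda>m j. \<psi> m (\<eta> j)", OF M \<psi>_le C] by blast
  have \<psi>u: "\<psi> m u = 0" for m using u by (auto simp: C_def)
  have \<psi>_lim: "\<exists>l. ((\<lambda>m. \<psi> m w) \<longlongrightarrow> l) (along A)" for w
  proof (cases "w \<in> C")
    case True
    then show ?thesis using \<eta> tame by (auto simp: tame_def)
  next
    case False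
    then have "(\<lambda>m. \<psi> m w) = (\<lambda>m. 0)" by (auto simp: C_def)
    then show ?thesis by (auto intro: tendsto_const)
  qed
  then obtain \<psi>' where \<psi>': "\<And>w. ((\<lambda>m. \<psi> m w) \<longlongrightarrow> \<psi>' w) (along A)" by metis
  have "\<exists>l. ((\<lambda>m. M m k) \<longlongrightarrow> l) (along A)" for k
    using tame by (auto simp: tame_def convergent_matrix_def)
  then obtain M' where M': "\<And>k. ((\<lambda>m. M m k) \<longlongrightarrow> M' k) (along A)" by metis
  obtain a where a: "((\<lambda>m. M m m) \<longlongrightarrow> a) (along A)" using tame by (auto simp: tame_def)
  \<comment> \<open>The final estimate loses
    \<open>3 * \<epsilon> * (P + 1) + 2 * \<epsilon>\<close>, which this choice keeps below
    \<open>3/32\<close>.\<close>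
  define \<epsilon> where "\<epsilon> = 1 / (32 * (P + 2))"
  have \<epsilon>: "\<epsilon> > 0" "\<epsilon> * (P + 2) = 1/32" using P by (auto simp: \<epsilon>_def)
  obtain N0 where N0: "\<And>m D. m \<in> A \<Longrightarrow> m \<ge> N0 \<Longrightarrow> finite D \<Longrightarrow>
      D \<subseteq> {k \<in> A. k \<ge> N0 \<and> k \<noteq> m} \<Longrightarrow> (\<Sum>k\<in>D. \<bar>M m k\<bar>) \<le> \<epsilon>"
    using tame \<epsilon>(1) unfolding tame_def nearly_diagonal_def by meson
  obtain n where n: "n \<ge> N0" "norm (x u - (\<Sum>k<n. v u k *\<^sub>R e k)) \<le> 1"
  proof -
    obtain N where "\<forall>n\<ge>N. norm (\<Sum>w\<in>{u}. 1 *\<^sub>R (x w - (\<Sum>k<n. v w k *\<^sub>R e k))) \<le> 1"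
      using x_sum[of "{u}" "\<lambda>_. 1"] by auto
    then show thesis using that[of "max N N0"] by simp
  qed
  define x' where "x' = x u - (\<Sum>k<n. v u k *\<^sub>R e k)"
  have x': "x' \<in> X" unfolding x'_def by (intro subspace_diff X x sumX)
  have \<phi>x: "\<phi> m (x u) = \<phi> m x' + (\<Sum>k<n. M m k * v u k)" for m
    by (simp add: x'_def linear_diff[OF \<phi>_lin] \<phi>_sum_e)
  have \<phi>x': "\<bar>\<phi> m x' - M m m * v u m\<bar> \<le> \<epsilon>" if m: "m \<in> A" "m \<ge> n" for m
  proof -
    \<comment> \<open>Without the initial segment and the entry at \<open>m\<close>, the support of
      \<open>v u\<close> lies in \<open>A\<close>, off the diagonal and beyond \<open>N0\<close>,
      where the row sums are at most \<open>\<epsilon>\<close>.\<close>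
    define w where "w = (\<lambda>k. if k < n \<or> k = m then 0 else v u k)"
    have w1: "\<bar>w k\<bar> \<le> 1" for k using v1 by (simp add: w_def)
    have "\<phi> m (x u) = mat_app M (v u) m" using \<psi>u[of m] by (simp add: \<psi>_def)
    also have "v u = (\<lambda>k. w k + (if k \<in> insert m {..<n} then v u k else 0))"
      by (auto simp: w_def)
    also have "mat_app M \<dots> m = mat_app M w m + mat_app M (\<lambda>k. if k \<in> insert m {..<n} then v u k else 0) m"
      using v1 by (intro mat_app_add[OF M w1, where D = 1]) auto
    also have "mat_app M (\<lambda>k. if k \<in> insert m {..<n} then v u k else 0) m =
        (\<Sum>k\<in>insert m {..<n}. M m k * v u k)"
      by (subst mat_app_finite_support[of "insert m {..<n}"]) auto
    also have "\<dots> = M m m * v u m + (\<Sum>k<n. M m k * v u k)" using m by simp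
    finally have "\<phi> m x' - M m m * v u m = mat_app M w m" using \<phi>x[of m] by simp
    moreover have "\<bar>mat_app M w m\<bar> \<le> (\<Sum>k. \<bar>M m k * w k\<bar>)"
      unfolding mat_app_def by (rule summable_rabs[OF mat_app_summable(1)[OF M w1]])
    moreover have "(\<Sum>k. \<bar>M m k * w k\<bar>) \<le> \<epsilon>"
    proof (rule suminf_le_const[OF mat_app_summable(1)[OF M w1]])
      fix K
      let ?D = "{k. k < K \<and> w k \<noteq> 0}"
      have "(\<Sum>k<K. \<bar>M m k * w k\<bar>) = (\<Sum>k\<in>?D. \<bar>M m k * w k\<bar>)"
        by (rule sum.mono_neutral_right) auto
      also have "\<dots> \<le> (\<Sum>k\<in>?D. \<bar>M m k\<bar>)"
        using w1 by (intro sum_mono) (simp add: abs_mult mult_left_le)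
      also have "\<dots> \<le> \<epsilon>"
        using m n(1) vA by (intro N0) (auto simp: w_def split: if_splits)
      finally show "(\<Sum>k<K. \<bar>M m k * w k\<bar>) \<le> \<epsilon>" .
    qed
    ultimately show ?thesis by simp
  qed
  \<comment> \<open>Here \<open>C(S)\<close> enters: it contains the absolute value of
    \<open>f x'\<close>, and \<open>g\<close> brings this back to an element of
    \<open>X\<close>.\<close>
  obtain h where h: "h \<in> cspace S"
      "\<And>s. s \<in> topspace S \<Longrightarrow> apply_bcontfun h (discrete s) = \<bar>apply_bcontfun (f x') (discrete s)\<bar>"
    using cspace_exists[OF S(1) continuous_map_real_abs[OF cspace_cont_map[OF fX[OF x']]]] by blast
  have h_abs: "apply_bcontfun h d = \<bar>apply_bcontfun (f x') d\<bar>" for d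
  proof (cases d)
    case (discrete s)
    then show ?thesis using h fX[OF x'] by (cases "s \<in> topspace S") (auto simp: cspace_def)
  qed
  define y where "y = g h"
  have y: "y \<in> X" "f y = h" using gX[OF h(1)] fg'[OF h(1)] by (auto simp: y_def)
  have \<phi>y: "\<phi> m y = \<bar>\<phi> m x'\<bar>" for m
    using q(1) by (simp add: \<phi>_def y h_abs abs_mult)
  have y_norm: "norm y \<le> P"
  proof -
    have "norm h \<le> norm (f x')"
      using norm_bounded[of "f x'"] by (intro norm_bound) (simp add: h_abs)
    also have "\<dots> \<le> Q * norm x'" by (rule Q(2)[OF x'])
    also have "\<dots> \<le> Q * 1" using n(2) Q(1) by (intro mult_left_mono) (auto simp: x'_def)
    finally have "q * norm h \<le> q * Q" using q(1) by (intro mult_left_mono) auto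
    then have "norm y \<le> q * Q" using q(2)[OF h(1)] unfolding y_def by linarith
    also have "\<dots> \<le> P" using q(1) Q(1) by (simp add: P_def)
    finally show ?thesis .
  qed
  \<comment> \<open>After applying \<open>\<phi> m\<close> the approximation error is at most
    \<open>P * \<kappa>\<close>, hence at most \<open>1/16\<close>.\<close>
  define \<kappa> where "\<kappa> = 1 / (16 * (P + 1))"
  have \<kappa>: "\<kappa> > 0" "\<kappa> \<le> 1" "P * \<kappa> \<le> 1/16" using P by (auto simp: \<kappa>_def field_simps)
  obtain F c D d where F: "finite F" "finite D" "\<And>w. w \<in> F \<Longrightarrow> c w \<in> \<rat> \<and> \<bar>c w\<bar> \<le> norm y + \<kappa>"
    and approx: "norm (y - ((\<Sum>w\<in>F. c w *\<^sub>R x w) + (\<Sum>k\<in>D. d k *\<^sub>R e k))) \<le> \<kappa>"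
    using dense[OF y(1) \<kappa>(1)] by blast
  define z where "z = (\<Sum>w\<in>F. c w *\<^sub>R x w) + (\<Sum>k\<in>D. d k *\<^sub>R e k)"
  have z: "z \<in> X" unfolding z_def by (intro subspace_add X sumX subspace_sum subspace_scale x)
  have \<phi>z: "\<bar>\<phi> m z - \<bar>\<phi> m x'\<bar>\<bar> \<le> 1/16" for m
  proof -
    have "\<bar>\<phi> m (y - z)\<bar> \<le> P * norm (y - z)" using \<phi>_le y z X by (simp add: subspace_diff)
    also have "\<dots> \<le> P * \<kappa>" using approx P by (intro mult_left_mono) (auto simp: z_def)
    finally show ?thesis using \<kappa>(3) by (simp add: linear_diff[OF \<phi>_lin] \<phi>y abs_minus_commute)
  qed
  \<comment> \<open>The coefficient of \<open>x u\<close> itself is treated apart, because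
    \<open>nonsep\<close> only concerns combinations that avoid \<open>u\<close>.\<close>
  define t where "t = (if u \<in> F then c u else 0)"
  have t: "\<bar>t\<bar> \<le> P + 1" using F(3)[of u] y_norm \<kappa>(2) P by (auto simp: t_def)
  define G where "G = F - {u}"
  have G: "finite G" "u \<notin> G" "\<forall>w\<in>G. c w \<in> \<rat>" using F by (auto simp: G_def)
  have split: "(\<Sum>w\<in>F. c w *\<^sub>R x w) = t *\<^sub>R x u + (\<Sum>w\<in>G. c w *\<^sub>R x w)"
    using F(1) by (cases "u \<in> F") (simp_all add: t_def G_def sum.remove)
  define comb where "comb = mat_app M (\<lambda>k. \<Sum>w\<in>G. c w * v w k)"
  \<comment> \<open>These are the terms that converge along \<open>A\<close>; far out they change
    differences by less than \<open>1/16\<close>.\<close>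
  define \<rho> where "\<rho> = (\<lambda>m. t * (\<Sum>k<n. M m k * v u k) + (\<Sum>w\<in>G. c w * \<psi> m w) + (\<Sum>k\<in>D. M m k * d k))"
  have comb: "comb m = \<phi> m z - t * \<phi> m x' - \<rho> m" for m
  proof -
    have "\<bar>c w * v w k\<bar> \<le> \<bar>c w\<bar>" for w k using v1[of w k] by (simp add: abs_mult mult_left_le)
    then have "comb m = (\<Sum>w\<in>G. mat_app M (\<lambda>k. c w * v w k) m)"
      unfolding comb_def by (rule mat_app_sum[OF M])
    also have "\<dots> = (\<Sum>w\<in>G. c w * (\<phi> m (x w) - \<psi> m w))"
      using mat_app_cmult[OF M v1] by (simp add: \<psi>_def)
    finally have "comb m = (\<Sum>w\<in>G. c w * \<phi> m (x w)) - (\<Sum>w\<in>G. c w * \<psi> m w)"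
      by (simp add: right_diff_distrib sum_subtractf)
    moreover have "\<phi> m z = t * \<phi> m (x u) + (\<Sum>w\<in>G. c w * \<phi> m (x w)) + (\<Sum>k\<in>D. M m k * d k)"
      unfolding z_def split
      by (simp only: linear_add[OF \<phi>_lin] \<phi>_sum_e) (simp add: linear_sum[OF \<phi>_lin] linear_scale[OF \<phi>_lin])
    ultimately show ?thesis by (simp add: \<rho>_def \<phi>x algebra_simps)
  qed
  have "((\<lambda>m. \<rho> m) \<longlongrightarrow> t * (\<Sum>k<n. M' k * v u k) + (\<Sum>w\<in>G. c w * \<psi>' w) + (\<Sum>k\<in>D. M' k * d k)) (along A)"
    unfolding \<rho>_def by (intro tendsto_intros M' \<psi>')
  then obtain \<rho>' where \<rho>': "(\<rho> \<longlongrightarrow> \<rho>') (along A)" by blast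
  have "\<forall>\<^sub>F m in along A. \<bar>\<rho> m - \<rho>'\<bar> < 1/32"
    using tendstoD[OF \<rho>', of "1/32"] by (simp add: dist_real_def)
  moreover have "\<forall>\<^sub>F m in along A. \<bar>M m m - a\<bar> < \<epsilon>"
    using tendstoD[OF a \<epsilon>(1)] by (simp add: dist_real_def)
  ultimately have "\<forall>\<^sub>F m in along A. \<bar>\<rho> m - \<rho>'\<bar> < 1/32 \<and> \<bar>M m m - a\<bar> < \<epsilon>"
    by (rule eventually_conj)
  then obtain N1 where N1: "\<And>m. m \<ge> N1 \<Longrightarrow> m \<in> A \<Longrightarrow> \<bar>\<rho> m - \<rho>'\<bar> < 1/32 \<and> \<bar>M m m - a\<bar> < \<epsilon>"
    by (auto simp: eventually_along)
  \<comment> \<open>Where \<open>v u\<close> is \<open>s\<close>, \<open>\<phi> m x'\<close> is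
    close to \<open>s * a\<close>. With this sign, subtracting \<open>t * \<phi> m x'\<close> does
    not reduce the gap, up to the error terms.\<close>
  define s :: real where "s = (if t * a \<le> 0 then 1 else -1)"
  have s: "s \<in> {1, -1}" "t * (s * a) \<le> 0" by (auto simp: s_def)
  have "separates comb A (v u) s (1/2)"
    unfolding separates_def
  proof (intro exI allI impI)
    fix i j assume i: "max n N1 \<le> i" "i \<in> A" "v u i = s" and j: "max n N1 \<le> j" "j \<in> A" "v u j = 0"
    have "\<bar>\<phi> i x' - M i i * s\<bar> \<le> \<epsilon>" "\<bar>\<phi> j x'\<bar> \<le> \<epsilon>"
      using \<phi>x'[of i] \<phi>x'[of j] i j by auto
    moreover have Mi: "\<bar>M i i - a\<bar> < \<epsilon>" "\<bar>\<rho> i - \<rho>'\<bar> < 1/32" "\<bar>\<rho> j - \<rho>'\<bar> < 1/32"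
      using N1[of i] N1[of j] i j by auto
    moreover have "\<bar>M i i * s - s * a\<bar> < \<epsilon>" using Mi s(1) by auto
    ultimately have 1: "\<bar>\<phi> i x' - \<phi> j x' - s * a\<bar> \<le> 3 * \<epsilon>" by linarith
    have "t * (\<phi> i x' - \<phi> j x') = t * (s * a) + t * (\<phi> i x' - \<phi> j x' - s * a)"
      by (simp add: algebra_simps)
    moreover have "t * (\<phi> i x' - \<phi> j x' - s * a) \<le> (P + 1) * (3 * \<epsilon>)"
    proof -
      have "\<bar>t * (\<phi> i x' - \<phi> j x' - s * a)\<bar> \<le> (P + 1) * (3 * \<epsilon>)"
        unfolding abs_mult using 1 t P by (intro mult_mono) auto
      then show ?thesis by linarith
    qed
    ultimately have 2: "t * (\<phi> i x' - \<phi> j x') \<le> 3 * \<epsilon> * (P + 1)" using s(2) by (simp add: mult.commute)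
    have "\<bar>M i i * s\<bar> \<ge> 1" using M1[of i] s(1) by auto
    then have 3: "\<bar>\<phi> i x'\<bar> \<ge> 1 - \<epsilon>" using \<open>\<bar>\<phi> i x' - M i i * s\<bar> \<le> \<epsilon>\<close> by linarith
    \<comment> \<open>The gap is at least \<open>1 - 1/8 - 1/16 - 3/32\<close>, the losses coming
      from \<open>z\<close>, from \<open>\<rho>\<close> and from the terms in
      \<open>\<epsilon>\<close>.\<close>
    have "3 * \<epsilon> * (P + 1) + 2 * \<epsilon> \<le> 3/32" using \<epsilon> by (simp add: algebra_simps)
    moreover have "comb i - comb j = \<phi> i z - \<phi> j z - t * (\<phi> i x' - \<phi> j x') - (\<rho> i - \<rho> j)"
      by (simp add: comb algebra_simps)
    ultimately show "1/2 \<le> comb i - comb j"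
      using 2 3 \<phi>z[of i] \<phi>z[of j] Mi \<open>\<bar>\<phi> j x'\<bar> \<le> \<epsilon>\<close> by linarith
  qed
  then show False using nonsep[OF G s(1)] by (simp add: comb_def)
qed

section \<open>A resolution of a \<open>\<Psi>\<close>-space determined by signs\<close>

text \<open>The even element is a tag and the odd elements carry the content, so all points of both
  spaces are sets of naturals.\<close>

definition enc :: "nat \<Rightarrow> nat set \<Rightarrow> nat set" where
  "enc i S = insert (2 * i) ((\<lambda>n. 2 * n + 1) ` S)"

definition tagged :: "nat \<Rightarrow> nat set \<Rightarrow> bool" where
  "tagged i x \<longleftrightarrow> 2 * i \<in> x"

definition body :: "nat set \<Rightarrow> nat set" where
  "body x = {n. 2 * n + 1 \<in> x}"

lemma tagged_enc [simp]: "tagged i (enc j S) \<longleftrightarrow> i = j"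
  by (auto simp: tagged_def enc_def) presburger+

lemma body_enc [simp]: "body (enc j S) = S"
  by (auto simp: body_def enc_def Suc_double_not_eq_double)

lemma enc_eq_iff [simp]: "enc i S = enc j T \<longleftrightarrow> i = j \<and> S = T"
  by (metis tagged_enc body_enc)

text \<open>Tags 0 and 1 serve both spaces and \<open>om\<close> is shared, so \<open>K\<close> sits
  inside \<open>L\<close> as the sheet \<open>True\<close>.\<close>

definition ptK :: "nat \<Rightarrow> nat set" where "ptK n = enc 0 {n}"
definition limK :: "nat set \<Rightarrow> nat set" where "limK u = enc 1 u"
definition om :: "nat set" where "om = enc 2 {}"
definition ptL :: "nat \<times> bool \<Rightarrow> nat set" where "ptL p = enc (if snd p then 0 else 3) {fst p}"
definition limL :: "nat set \<times> bool \<Rightarrow> nat set" where "limL g = enc (if snd g then 1 else 4) (fst g)"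

lemmas point_defs = ptK_def limK_def om_def ptL_def limL_def

text \<open>The two sheets of the resolution are the points tagged 0, 1 and those tagged 3, 4.\<close>

definition switch :: "nat set \<Rightarrow> nat set" where
  "switch x = (if tagged 0 x then enc 3 (body x) else if tagged 3 x then enc 0 (body x)
          else if tagged 1 x then enc 4 (body x) else if tagged 4 x then enc 1 (body x) else x)"

definition collapse :: "nat set \<Rightarrow> nat set" where
  "collapse x = (if tagged 3 x then enc 0 (body x) else if tagged 4 x then enc 1 (body x) else x)"

lemma switch_simps [simp]: "switch (ptL p) = ptL (fst p, \<not> snd p)" "switch (limL g) = limL (fst g, \<not> snd g)" "switch om = om"
  by (auto simp: switch_def point_defs)

lemma collapse_simps [simp]: "collapse (ptL p) = ptK (fst p)" "collapse (limL g) = limK (fst g)" "collapse om = om"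
  by (auto simp: collapse_def point_defs)

lemma K_as_L: "ptK n = ptL (n, True)" "limK u = limL (u, True)"
  by (auto simp: point_defs)

locale signed_family =
  fixes v :: "nat set \<Rightarrow> nat \<Rightarrow> real"
  assumes v_cases: "v u k \<in> {-1, 0, 1}"
    and v_infinite: "infinite {k. v u k = 1}"
    and v_almost_disjoint: "u \<noteq> w \<Longrightarrow> finite {k. v u k \<noteq> 0 \<and> v w k \<noteq> 0}"
begin

definition GK :: "nat set \<Rightarrow> nat set" where
  "GK u = {k. v u k \<noteq> 0}"

text \<open>With this twist the odd function equal to \<open>v u\<close> on the sheet
  \<open>True\<close> takes the value 1 on all of \<open>GL (u, True)\<close>, hence extends
  continuously to its limit.\<close>

definition GL :: "nat set \<times> bool \<Rightarrow> (nat \<times> bool) set" where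
  "GL g = {p. v (fst g) (fst p) = (if snd g = snd p then 1 else -1)}"

lemma GL_fst: "p \<in> GL g \<Longrightarrow> fst p \<in> GK (fst g)"
  by (auto simp: GL_def GK_def split: if_splits)

lemma GK_GL: "n \<in> GK u \<Longrightarrow> \<exists>c. (n, b) \<in> GL (u, c)"
  using v_cases[of u n] by (cases b) (auto simp: GL_def GK_def)

sublocale K: psi_space ptK limK om GK
proof
  show "inj ptK" "inj limK" by (auto simp: inj_def point_defs)
  show "infinite (GK u)" for u
    using v_infinite[of u] unfolding GK_def by (rule contrapos_nn) (rule finite_subset[rotated], auto)
  show "finite (GK u \<inter> GK w)" if "u \<noteq> w" for u w
    using v_almost_disjoint[OF that] by (rule rev_finite_subset) (auto simp: GK_def)
qed (auto simp: point_defs)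

sublocale L: psi_space ptL limL om GL
proof
  show "inj ptL" "inj limL" by (auto simp: inj_def point_defs split: if_splits)
  show "infinite (GL g)" for g
  proof
    assume "finite (GL g)"
    then have "finite (fst ` GL g)" by simp
    moreover have "{k. v (fst g) k = 1} \<subseteq> fst ` GL g"
      by (auto simp: GL_def intro!: image_eqI[of _ fst "(_, snd g)"])
    ultimately show False using v_infinite finite_subset by blast
  qed
  show "finite (GL g \<inter> GL h)" if "g \<noteq> h" for g h
  proof (cases "fst g = fst h")
    case True
    then have "GL g \<inter> GL h = {}" using that by (auto simp: GL_def prod_eq_iff split: if_splits)
    then show ?thesis by simp
  next
    case False
    have "GL g \<inter> GL h \<subseteq> {k. v (fst g) k \<noteq> 0 \<and> v (fst h) k \<noteq> 0} \<times> UNIV"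
      using GL_fst by (fastforce simp: GK_def)
    then show ?thesis by (rule finite_subset) (simp add: v_almost_disjoint[OF False])
  qed
qed (auto simp: point_defs split: if_splits)

lemma switch_point: "x \<in> L.points \<Longrightarrow> switch x \<in> L.points"
  by (erule L.points_cases) auto

lemma switch_switch: "x \<in> L.points \<Longrightarrow> switch (switch x) = x"
  by (erule L.points_cases) auto

lemma collapse_switch: "x \<in> L.points \<Longrightarrow> collapse (switch x) = collapse x"
  by (erule L.points_cases) auto

lemma collapse_cases: "x \<in> L.points \<Longrightarrow> collapse x = x \<or> collapse x = switch x"
proof (erule L.points_cases)
  fix p assume "x = ptL p" then show ?thesis by (cases p; cases "snd p") (auto simp: K_as_L)
next
  fix g assume "x = limL g" then show ?thesis by (cases g; cases "snd g") (auto simp: K_as_L)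
qed auto

lemma collapse_point: "x \<in> L.points \<Longrightarrow> collapse x \<in> K.points"
  by (erule L.points_cases) auto

lemma K_points_L: "x \<in> K.points \<Longrightarrow> x \<in> L.points \<and> collapse x = x"
  by (erule K.points_cases) (auto simp: K_as_L)

lemma collapse_surj: "collapse ` topspace L.psi = topspace K.psi"
  unfolding L.topspace_psi K.topspace_psi using collapse_point K_points_L by force

lemma continuous_collapse: "continuous_map L.psi K.psi collapse"
  unfolding continuous_map_def
proof (intro conjI allI impI funcsetI)
  show "collapse x \<in> topspace K.psi" if "x \<in> topspace L.psi" for x
    using that collapse_point by (simp add: L.topspace_psi K.topspace_psi)
  fix U assume "openin K.psi U"
  then have U: "K.is_open U" by (simp add: K.openin_psi)
  define W where "W = {x \<in> topspace L.psi. collapse x \<in> U}"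
  have W: "ptL p \<in> W \<longleftrightarrow> ptK (fst p) \<in> U" "limL g \<in> W \<longleftrightarrow> limK (fst g) \<in> U" "om \<in> W \<longleftrightarrow> om \<in> U" for p g
    by (auto simp: W_def L.topspace_psi)
  have "L.is_open W"
  proof (rule L.is_openI)
    show "W \<subseteq> L.points" by (auto simp: W_def L.topspace_psi)
  next
    fix g assume "limL g \<in> W"
    then have fin: "finite ({n \<in> GK (fst g). ptK n \<notin> U} \<times> (UNIV :: bool set))"
      using U W by (auto simp: K.is_open_def)
    show "finite {p \<in> GL g. ptL p \<notin> W}"
      by (rule finite_subset[OF _ fin]) (auto simp: W dest: GL_fst)
  next
    assume "om \<in> W"
    then obtain H where H: "finite H" "\<forall>u. u \<notin> H \<longrightarrow> limK u \<in> U" "finite {n. ptK n \<notin> U \<and> n \<notin> \<Union> (GK ` H)}"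
      using U W(3) unfolding K.is_open_def by blast
    \<comment> \<open>Both limits over each exceptional index are removed, and every point over
      \<open>GK u\<close> belongs to one of their two sets.\<close>
    have "{p. ptL p \<notin> W \<and> p \<notin> \<Union> (GL ` (H \<times> UNIV))} \<subseteq> {n. ptK n \<notin> U \<and> n \<notin> \<Union> (GK ` H)} \<times> UNIV"
      using GK_GL by (fastforce simp: W)
    then have "finite {p. ptL p \<notin> W \<and> p \<notin> \<Union> (GL ` (H \<times> UNIV))}"
      by (rule finite_subset) (use H in simp)
    then show "\<exists>H. finite H \<and> (\<forall>g. g \<notin> H \<longrightarrow> limL g \<in> W) \<and> finite {p. ptL p \<notin> W \<and> p \<notin> \<Union> (GL ` H)}"
      using H by (intro exI[of _ "H \<times> UNIV"]) (auto simp: W)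
  qed
  then show "openin L.psi {x \<in> topspace L.psi. collapse x \<in> U}" by (simp add: W_def L.openin_psi)
qed

lemma continuous_switch: "continuous_map L.psi L.psi switch"
  unfolding continuous_map_def
proof (intro conjI allI impI funcsetI)
  show "switch x \<in> topspace L.psi" if "x \<in> topspace L.psi" for x
    using that switch_point by (simp add: L.topspace_psi)
  fix U assume "openin L.psi U"
  then have U: "L.is_open U" by (simp add: L.openin_psi)
  define flip :: "nat \<times> bool \<Rightarrow> nat \<times> bool" where "flip = (\<lambda>p. (fst p, \<not> snd p))"
  define flip' :: "nat set \<times> bool \<Rightarrow> nat set \<times> bool" where "flip' = (\<lambda>p. (fst p, \<not> snd p))"
  have inj: "inj flip" by (auto simp: inj_def flip_def prod_eq_iff)
  have GL_flip: "flip p \<in> GL (flip' g) \<longleftrightarrow> p \<in> GL g" for p g by (auto simp: GL_def flip_def flip'_def)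
  have flip'_flip': "flip' (flip' g) = g" for g by (simp add: flip'_def)
  define W where "W = {x \<in> topspace L.psi. switch x \<in> U}"
  have W: "ptL p \<in> W \<longleftrightarrow> ptL (flip p) \<in> U" "limL g \<in> W \<longleftrightarrow> limL (flip' g) \<in> U" "om \<in> W \<longleftrightarrow> om \<in> U" for p g
    by (auto simp: W_def L.topspace_psi flip_def flip'_def)
  have "L.is_open W"
  proof (rule L.is_openI)
    show "W \<subseteq> L.points" by (auto simp: W_def L.topspace_psi)
  next
    fix g assume "limL g \<in> W"
    then have "finite {p \<in> GL (flip' g). ptL p \<notin> U}"
      using U W(2)[of g] unfolding L.is_open_def by blast
    then have "finite (flip -` {p \<in> GL (flip' g). ptL p \<notin> U})" using inj by (rule finite_vimageI)
    then show "finite {p \<in> GL g. ptL p \<notin> W}"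
      by (rule rev_finite_subset) (auto simp: W GL_flip)
  next
    assume "om \<in> W"
    then obtain H where H: "finite H" "\<forall>g. g \<notin> H \<longrightarrow> limL g \<in> U" "finite {p. ptL p \<notin> U \<and> p \<notin> \<Union> (GL ` H)}"
      using U W(3) unfolding L.is_open_def by blast
    have "finite (flip -` {p. ptL p \<notin> U \<and> p \<notin> \<Union> (GL ` H)})" using H(3) inj by (rule finite_vimageI)
    then have "finite {p. ptL p \<notin> W \<and> p \<notin> \<Union> (GL ` (flip' ` H))}"
    proof (rule rev_finite_subset, intro subsetI, clarsimp simp: W)
      fix n b g assume "\<forall>h\<in>H. (n, b) \<notin> GL (flip' h)" "flip (n, b) \<in> GL g" "g \<in> H"
      then show False using GL_flip[of "(n, b)" "flip' g"] by (simp add: flip'_flip')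
    qed
    moreover have "limL g \<in> W" if "g \<notin> flip' ` H" for g
      using that H(2) flip'_flip'[of g] by (metis W(2) image_eqI)
    ultimately show "\<exists>H. finite H \<and> (\<forall>g. g \<notin> H \<longrightarrow> limL g \<in> W) \<and> finite {p. ptL p \<notin> W \<and> p \<notin> \<Union> (GL ` H)}"
      using H(1) by blast
  qed
  then show "openin L.psi {x \<in> topspace L.psi. switch x \<in> U}" by (simp add: W_def L.openin_psi)
qed

section \<open>Even and odd functions on the resolution\<close>

abbreviation val :: "(nat set discrete \<Rightarrow>\<^sub>C real) \<Rightarrow> nat set \<Rightarrow> real" where
  "val f x \<equiv> apply_bcontfun f (discrete x)"

lemma cspace_eqI:
  assumes "f \<in> cspace L.psi" "g \<in> cspace L.psi" "\<And>x. x \<in> L.points \<Longrightarrow> val f x = val g x"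
  shows "f = g"
proof (rule discrete_bcontfun_eqI)
  show "val f x = val g x" for x
    using assms by (cases "x \<in> L.points") (auto simp: cspace_def L.topspace_psi)
qed

lemma norm_cspace_le:
  assumes f: "f \<in> cspace L.psi" and le: "\<And>p. \<bar>val f (ptL p)\<bar> \<le> r" "\<And>g. \<bar>val f (limL g)\<bar> \<le> r" "\<bar>val f om\<bar> \<le> r"
  shows "norm f \<le> r"
proof (rule norm_bound)
  fix d show "norm (apply_bcontfun f d) \<le> r"
  proof (cases d)
    case (discrete x)
    show ?thesis
    proof (cases "x \<in> L.points")
      case True
      then show ?thesis unfolding discrete by (cases rule: L.points_cases) (use le in auto)
    next
      case False
      then show ?thesis using f le(3) discrete by (simp add: cspace_def L.topspace_psi)
    qed
  qed
qed

lemma val_comp_switch: "x \<in> L.points \<Longrightarrow> val (comp_op L.psi switch f) x = val f (switch x)"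
  by (simp add: comp_op_apply L.topspace_psi)

sublocale invol: isometric_involution "cspace L.psi" "comp_op L.psi switch"
proof
  show R_in: "comp_op L.psi switch f \<in> cspace L.psi" if "f \<in> cspace L.psi" for f
    using comp_op_in_cspace[OF continuous_switch that] .
  show "comp_op L.psi switch (comp_op L.psi switch f) = f" if "f \<in> cspace L.psi" for f
    by (rule cspace_eqI) (simp_all add: R_in that val_comp_switch switch_point switch_switch)
qed (simp_all add: subspace_cspace closed_cspace norm_comp_op_le linear_add[OF linear_comp_op]
      linear_scale[OF linear_comp_op])

abbreviation X :: "(nat set discrete \<Rightarrow>\<^sub>C real) set" where
  "X \<equiv> invol.eigen (-1)"

lemma eigen_iff:
  "f \<in> invol.eigen s \<longleftrightarrow> f \<in> cspace L.psi \<and> (\<forall>x\<in>L.points. val f (switch x) = s * val f x)"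
proof
  assume "f \<in> invol.eigen s"
  then have f: "f \<in> cspace L.psi" "comp_op L.psi switch f = s *\<^sub>R f" by (auto simp: invol.eigen_def)
  have "val f (switch x) = s * val f x" if "x \<in> L.points" for x
    using val_comp_switch[OF that, of f] f(2) by simp
  then show "f \<in> cspace L.psi \<and> (\<forall>x\<in>L.points. val f (switch x) = s * val f x)" using f by blast
next
  assume f: "f \<in> cspace L.psi \<and> (\<forall>x\<in>L.points. val f (switch x) = s * val f x)"
  have "comp_op L.psi switch f = s *\<^sub>R f"
    using f by (intro cspace_eqI invol.R_in subspace_scale subspace_cspace) (simp_all add: val_comp_switch)
  then show "f \<in> invol.eigen s" using f by (simp add: invol.eigen_def)
qed

text \<open>An even function is unchanged by composition with \<open>collapse\<close>, a quotient
  map since it maps a compact space onto a Hausdorff one. As points of \<open>K\<close> are points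
  of \<open>L\<close>, the function induced on \<open>K\<close> is \<open>val f\<close>
  itself.\<close>

lemma comp_collapse_eigen: "comp_op L.psi collapse ` cspace K.psi = invol.eigen 1"
proof (intro equalityI subsetI)
  fix f assume "f \<in> comp_op L.psi collapse ` cspace K.psi"
  then obtain g where g: "g \<in> cspace K.psi" "f = comp_op L.psi collapse g" by blast
  have "f \<in> cspace L.psi" unfolding g(2) by (rule comp_op_in_cspace[OF continuous_collapse g(1)])
  then show "f \<in> invol.eigen 1"
    by (simp add: eigen_iff g(2) comp_op_apply L.topspace_psi switch_point collapse_switch)
next
  fix f assume f: "f \<in> invol.eigen 1"
  then have fL: "f \<in> cspace L.psi" by (simp add: eigen_iff)
  have inv: "val f (collapse x) = val f x" if "x \<in> L.points" for x
  proof -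
    have "val f (switch x) = val f x" using f that by (simp add: eigen_iff)
    then show ?thesis using collapse_cases[OF that] by metis
  qed
  have "continuous_map L.psi euclideanreal (val f \<circ> collapse)"
    by (rule continuous_map_eq[OF cspace_cont_map[OF fL]]) (simp add: inv L.topspace_psi)
  moreover have "quotient_map L.psi K.psi collapse"
    using continuous_collapse L.compact_psi K.Hausdorff_psi collapse_surj by (rule continuous_imp_quotient_map)
  ultimately have "continuous_map K.psi euclideanreal (val f)"
    by (simp add: continuous_compose_quotient_map_eq)
  then obtain g where g: "g \<in> cspace K.psi" "\<And>x. x \<in> topspace K.psi \<Longrightarrow> val g x = val f x"
    by (rule cspace_exists[OF K.compact_psi]) blast
  have "comp_op L.psi collapse g = f"
    using fL g(1)
    by (intro cspace_eqI comp_op_in_cspace[OF continuous_collapse])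
      (simp_all add: comp_op_apply L.topspace_psi g(2) K.topspace_psi collapse_point inv)
  then show "f \<in> comp_op L.psi collapse ` cspace K.psi" using g(1) by blast
qed

lemma clopen_difference:
  assumes "openin L.psi C" "closedin L.psi C" "openin L.psi D" "closedin L.psi D"
  shows "\<exists>f \<in> cspace L.psi. \<forall>x\<in>L.points. val f x = indicator C x - indicator D x"
proof -
  have "continuous_map L.psi euclideanreal (\<lambda>x. indicator C x - indicator D x)"
    using assms by (intro continuous_map_diff continuous_indicator_clopen)
  then obtain f where "f \<in> cspace L.psi"
      "\<And>x. x \<in> topspace L.psi \<Longrightarrow> val f x = indicator C x - indicator D x"
    by (rule cspace_exists[OF L.compact_psi]) blast
  then show ?thesis by (auto simp: L.topspace_psi)
qed

text \<open>The functions \<open>unit_vec k\<close> and \<open>sign_vec u\<close> play the roles of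
  \<open>e k\<close> and \<open>x u\<close> in the criterion.\<close>

definition unit_vec :: "nat \<Rightarrow> (nat set discrete \<Rightarrow>\<^sub>C real)" where
  "unit_vec k = (SOME f. f \<in> cspace L.psi \<and>
     (\<forall>x\<in>L.points. val f x = indicator {ptL (k, True)} x - indicator {ptL (k, False)} x))"

definition sign_vec :: "nat set \<Rightarrow> (nat set discrete \<Rightarrow>\<^sub>C real)" where
  "sign_vec u = (SOME f. f \<in> cspace L.psi \<and>
     (\<forall>y\<in>L.points. val f y = indicator (L.nbhd (u, True)) y - indicator (L.nbhd (u, False)) y))"

lemma unit_vec:
  shows "unit_vec k \<in> cspace L.psi"
    and "y \<in> L.points \<Longrightarrow> val (unit_vec k) y = indicator {ptL (k, True)} y - indicator {ptL (k, False)} y"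
proof -
  have "unit_vec k \<in> cspace L.psi \<and>
      (\<forall>y\<in>L.points. val (unit_vec k) y = indicator {ptL (k, True)} y - indicator {ptL (k, False)} y)"
    unfolding unit_vec_def
    by (rule someI_ex) (rule clopen_difference[OF L.openin_pt L.closedin_pt L.openin_pt L.closedin_pt,
        unfolded Bex_def])
  then show "unit_vec k \<in> cspace L.psi"
    and "y \<in> L.points \<Longrightarrow> val (unit_vec k) y = indicator {ptL (k, True)} y - indicator {ptL (k, False)} y"
    by blast+
qed

lemma sign_vec:
  shows "sign_vec u \<in> cspace L.psi"
    and "y \<in> L.points \<Longrightarrow> val (sign_vec u) y = indicator (L.nbhd (u, True)) y - indicator (L.nbhd (u, False)) y"
proof -
  have "sign_vec u \<in> cspace L.psi \<and>
      (\<forall>y\<in>L.points. val (sign_vec u) y = indicator (L.nbhd (u, True)) y - indicator (L.nbhd (u, False)) y)"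
    unfolding sign_vec_def
    by (rule someI_ex) (rule clopen_difference[OF L.openin_nbhd L.closedin_nbhd L.openin_nbhd L.closedin_nbhd,
        unfolded Bex_def])
  then show "sign_vec u \<in> cspace L.psi"
    and "y \<in> L.points \<Longrightarrow> val (sign_vec u) y = indicator (L.nbhd (u, True)) y - indicator (L.nbhd (u, False)) y"
    by blast+
qed

lemma val_unit_vec [simp]:
  "val (unit_vec k) (ptL p) = (if fst p = k then (if snd p then 1 else -1) else 0)"
  "val (unit_vec k) (limL g) = 0" "val (unit_vec k) om = 0"
  by (auto simp: unit_vec indicator_def prod_eq_iff)

lemma val_sign_vec [simp]:
  "val (sign_vec u) (ptL p) = (if snd p then v u (fst p) else - v u (fst p))"
  "val (sign_vec u) (limL g) = (if fst g = u then (if snd g then 1 else -1) else 0)"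
  "val (sign_vec u) om = 0"
  using v_cases[of u "fst p"] by (auto simp: sign_vec indicator_def GL_def prod_eq_iff)

lemma unit_vec_in_X: "unit_vec k \<in> X"
  unfolding eigen_iff by (auto simp: unit_vec(1) elim!: L.points_cases)

lemma sign_vec_in_X: "sign_vec u \<in> X"
  unfolding eigen_iff by (auto simp: sign_vec(1) elim!: L.points_cases)

lemma val_sum: "val (\<Sum>i\<in>I. f i) y = (\<Sum>i\<in>I. val (f i) y)"
  by (induction I rule: infinite_finite_induct) auto

lemma X_cspace: "f \<in> X \<Longrightarrow> f \<in> cspace L.psi"
  by (simp add: eigen_iff)

lemma val_X:
  assumes "f \<in> X"
  shows "val f (ptL (n, False)) = - val f (ptL (n, True))" "val f (limL (u, False)) = - val f (limL (u, True))"
    "val f om = 0"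
proof -
  have odd: "val f (switch y) = - val f y" if "y \<in> L.points" for y
    using assms that by (simp add: eigen_iff)
  show "val f (ptL (n, False)) = - val f (ptL (n, True))" using odd[of "ptL (n, True)"] by simp
  show "val f (limL (u, False)) = - val f (limL (u, True))" using odd[of "limL (u, True)"] by simp
  show "val f om = 0" using odd[of om] by simp
qed

lemma norm_X_le:
  assumes f: "f \<in> X" and r: "0 \<le> r"
    and le: "\<And>n. \<bar>val f (ptL (n, True))\<bar> \<le> r" "\<And>u. \<bar>val f (limL (u, True))\<bar> \<le> r"
  shows "norm f \<le> r"
proof (rule norm_cspace_le[OF X_cspace[OF f]])
  show "\<bar>val f (ptL p)\<bar> \<le> r" for p using le val_X[OF f] by (cases p; cases "snd p") auto
  show "\<bar>val f (limL g)\<bar> \<le> r" for g using le val_X[OF f] by (cases g; cases "snd g") auto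
  show "\<bar>val f om\<bar> \<le> r" using val_X(3)[OF f] r by simp
qed

lemma abs_val_le: "\<bar>val f y\<bar> \<le> norm f"
  using norm_bounded[of f "discrete y"] by simp

lemma norm_unit_vec: "norm (unit_vec k) \<ge> 1"
  using abs_val_le[of "unit_vec k" "ptL (k, True)"] by simp

lemma sum_unit_vec_in_X: "(\<Sum>k\<in>D. c k *\<^sub>R unit_vec k) \<in> X"
  by (intro subspace_sum subspace_scale invol.subspace_eigen unit_vec_in_X)

lemma sum_sign_vec_in_X: "(\<Sum>u\<in>D. c u *\<^sub>R sign_vec u) \<in> X"
  by (intro subspace_sum subspace_scale invol.subspace_eigen sign_vec_in_X)

lemma val_sum_unit_vec:
  assumes "finite D"
  shows "val (\<Sum>k\<in>D. c k *\<^sub>R unit_vec k) (ptL (n, True)) = (if n \<in> D then c n else 0)"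
    "val (\<Sum>k\<in>D. c k *\<^sub>R unit_vec k) (limL g) = 0"
  using assms by (simp_all add: val_sum if_distrib[of "\<lambda>t. _ * t"] cong: if_cong)

lemma norm_sum_unit_vec:
  assumes "finite D" "\<And>k. \<bar>c k\<bar> \<le> 1"
  shows "norm (\<Sum>k\<in>D. c k *\<^sub>R unit_vec k) \<le> 1"
  using assms by (intro norm_X_le sum_unit_vec_in_X) (simp_all add: val_sum_unit_vec)

text \<open>Beyond the finite set of overlaps the supports are disjoint, so at most one summand is
  nonzero at each isolated point; at a limit only its own coefficient appears.\<close>

lemma norm_sum_sign_vec_tail:
  assumes F: "finite F" and c: "\<And>u. \<bar>c u\<bar> \<le> 1"
  shows "\<exists>N. \<forall>n\<ge>N. norm (\<Sum>u\<in>F. c u *\<^sub>R (sign_vec u - (\<Sum>k<n. v u k *\<^sub>R unit_vec k))) \<le> 1"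
proof -
  define Z where "Z = (\<Union>u\<in>F. \<Union>w\<in>F - {u}. {k. v u k \<noteq> 0 \<and> v w k \<noteq> 0})"
  have "finite Z" unfolding Z_def by (intro finite_UN_I finite_Diff F v_almost_disjoint) auto
  then obtain N where N: "\<And>k. k \<in> Z \<Longrightarrow> k < N" unfolding finite_nat_set_iff_bounded by blast
  have "norm (\<Sum>u\<in>F. c u *\<^sub>R (sign_vec u - (\<Sum>k<n. v u k *\<^sub>R unit_vec k))) \<le> 1" (is "norm ?y \<le> 1") if n: "n \<ge> N" for n
  proof (rule norm_X_le)
    show "?y \<in> X"
      by (rule subspace_sum[OF invol.subspace_eigen], rule subspace_scale[OF invol.subspace_eigen],
          rule subspace_diff[OF invol.subspace_eigen sign_vec_in_X sum_unit_vec_in_X])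
    fix m
    have "val ?y (ptL (m, True)) = (\<Sum>u\<in>F. c u * (v u m - (if m < n then v u m else 0)))"
      by (simp add: val_sum[of _ F] val_sum_unit_vec)
    also have "\<dots> = (\<Sum>u\<in>F. c u * (if m < n then 0 else v u m))"
      by (intro sum.cong) auto
    finally have "val ?y (ptL (m, True)) = (\<Sum>u\<in>F. c u * (if m < n then 0 else v u m))" .
    moreover have "\<bar>\<Sum>u\<in>F. c u * v u m\<bar> \<le> 1" if "m \<ge> n"
    proof (rule abs_sum_single_le[OF F])
      show "c u * v u m = 0 \<or> c w * v w m = 0" if "u \<in> F" "w \<in> F" "u \<noteq> w" for u w
        using that N[of m] n \<open>m \<ge> n\<close> by (fastforce simp: Z_def)
      show "\<bar>c u * v u m\<bar> \<le> 1" for u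
        using c[of u] v_cases[of u m] by auto
    qed simp
    ultimately show "\<bar>val ?y (ptL (m, True))\<bar> \<le> 1" by (cases "m < n") auto
    fix w
    have "val ?y (limL (w, True)) = (if w \<in> F then c w else 0)"
      using F by (simp add: val_sum[of _ F] val_sum_unit_vec if_distrib[of "\<lambda>t. _ * t"] cong: if_cong)
    then show "\<bar>val ?y (limL (w, True))\<bar> \<le> 1" using c by simp
  qed simp
  then show ?thesis by blast
qed

text \<open>Rational multiples of \<open>sign_vec\<close> first bring the finitely many large limit
  values below \<open>r\<close>. Then only finitely many isolated points keep a value of size
  \<open>r\<close> or more, and multiples of \<open>unit_vec\<close> cancel these exactly.\<close>

lemma dense_combinations:
  assumes y: "y \<in> X" and r: "r > 0"
  shows "\<exists>F c D d. finite F \<and> finite D \<and> (\<forall>u\<in>F. c u \<in> \<rat> \<and> \<bar>c u\<bar> \<le> norm y + r) \<and>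
       norm (y - ((\<Sum>u\<in>F. c u *\<^sub>R sign_vec u) + (\<Sum>k\<in>D. d k *\<^sub>R unit_vec k))) \<le> r"
proof -
  define F where "F = {u. \<bar>val y (limL (u, True))\<bar> \<ge> r}"
  have "finite {g. \<bar>val y (limL g)\<bar> \<ge> r}"
    by (rule L.finite_lim_ge[OF cspace_cont_map[OF X_cspace[OF y]] r val_X(3)[OF y]])
  then have "finite (fst ` {g. \<bar>val y (limL g)\<bar> \<ge> r})" by simp
  then have F: "finite F" by (rule rev_finite_subset) (force simp: F_def)
  have "\<exists>q\<in>\<rat>. val y (limL (u, True)) - r < q \<and> q < val y (limL (u, True))" for u
    using r by (intro Rats_dense_in_real) simp
  then obtain c where c: "\<And>u. c u \<in> \<rat>" "\<And>u. val y (limL (u, True)) - r < c u" "\<And>u. c u < val y (limL (u, True))"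
    by metis
  define z where "z = y - (\<Sum>u\<in>F. c u *\<^sub>R sign_vec u)"
  have z: "z \<in> X" unfolding z_def by (intro subspace_diff invol.subspace_eigen y sum_sign_vec_in_X)
  have zl: "\<bar>val z (limL (u, True))\<bar> < r" for u
  proof -
    have "val z (limL (u, True)) = val y (limL (u, True)) - (if u \<in> F then c u else 0)"
      using F by (simp add: z_def val_sum if_distrib[of "\<lambda>t. _ * t"] cong: if_cong)
    then show ?thesis using c[of u] by (auto simp: F_def)
  qed
  then have "\<bar>val z (limL g)\<bar> < r" for g
    using val_X(2)[OF z] by (cases g; cases "snd g") auto
  then have "finite {p. \<bar>val z (ptL p)\<bar> \<ge> r}"
    by (rule L.finite_pt_ge[OF cspace_cont_map[OF X_cspace[OF z]] r val_X(3)[OF z]])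
  then have "finite (fst ` {p. \<bar>val z (ptL p)\<bar> \<ge> r})" by simp
  then have D: "finite {n. \<bar>val z (ptL (n, True))\<bar> \<ge> r}" (is "finite ?D") by (rule rev_finite_subset) force
  define d where "d = (\<lambda>n. val z (ptL (n, True)))"
  have "norm (z - (\<Sum>k\<in>?D. d k *\<^sub>R unit_vec k)) \<le> r"
  proof (rule norm_X_le)
    show "z - (\<Sum>k\<in>?D. d k *\<^sub>R unit_vec k) \<in> X" by (intro subspace_diff invol.subspace_eigen z sum_unit_vec_in_X)
    show "\<bar>val (z - (\<Sum>k\<in>?D. d k *\<^sub>R unit_vec k)) (ptL (n, True))\<bar> \<le> r" for n
      using r by (simp add: val_sum_unit_vec[OF D] d_def)
    show "\<bar>val (z - (\<Sum>k\<in>?D. d k *\<^sub>R unit_vec k)) (limL (u, True))\<bar> \<le> r" for u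
      using zl[of u] by (simp add: val_sum_unit_vec[OF D])
  qed (use r in simp)
  moreover have "\<bar>c u\<bar> \<le> norm y + r" for u
    using c[of u] abs_val_le[of y "limL (u, True)"] by linarith
  ultimately show ?thesis using F D c(1) unfolding z_def diff_diff_eq by blast
qed

end

section \<open>The example from an adversarial family\<close>

theorem theorem1p3:
  shows "\<exists>(K :: nat set topology) (L :: nat set topology) \<theta> X.
      compact_space K \<and> Hausdorff_space K \<and> separable_space K \<and> scattered_space K \<and>
      topspace ((derivative ^^ 3) K) = {} \<and>
      compact_space L \<and> Hausdorff_space L \<and> separable_space L \<and> scattered_space L \<and>
      topspace ((derivative ^^ 3) L) = {} \<and>
      continuous_map L K \<theta> \<and> \<theta> ` topspace L = topspace K \<and>
      subspace X \<and> closed X \<and> X \<subseteq> cspace L \<and>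
      banach_isomorphic (cspace L) ((comp_op L \<theta> ` cspace K) \<times> X) \<and>
      one_complemented (comp_op L \<theta> ` cspace K) (cspace L) \<and>
      one_complemented X (cspace L) \<and>
      \<not> is_C_space X"
proof (rule adversarial_family)
  fix v :: "nat set \<Rightarrow> nat \<Rightarrow> real"
  assume v: "\<And>u k. v u k \<in> {-1, 0, 1}" "\<And>u. infinite {k. v u k = 1}"
      "\<And>u w. u \<noteq> w \<Longrightarrow> finite {k. v u k \<noteq> 0 \<and> v w k \<noteq> 0}"
    and adversarial: "\<And>M M' B B' C. rows_bounded B M \<Longrightarrow> (\<And>m j. \<bar>M' m j\<bar> \<le> B') \<Longrightarrow> countable C \<Longrightarrow>
       \<exists>u A. u \<notin> C \<and> tame A M M' \<and> (\<forall>k. v u k \<noteq> 0 \<longrightarrow> k \<in> A) \<and>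
         (\<forall>F c s. finite F \<longrightarrow> u \<notin> F \<longrightarrow> (\<forall>w\<in>F. c w \<in> \<rat>) \<longrightarrow> s \<in> {1, -1} \<longrightarrow>
            \<not> separates (mat_app M (\<lambda>k. \<Sum>w\<in>F. c w * v w k)) A (v u) s (1/2))"
  interpret signed_family v
    by standard (rule v)+
  \<comment> \<open>The constant function 1 is a nonzero even vector, as \<open>unit_vec 0\<close>
    is a nonzero odd one; with them both projections have norm exactly one.\<close>
  obtain g where g: "g \<in> cspace L.psi" "\<And>y. y \<in> topspace L.psi \<Longrightarrow> val g y = 1"
    using cspace_exists[OF L.compact_psi, of "\<lambda>_. 1"] by auto
  then have "g \<in> invol.eigen 1"
    by (simp add: eigen_iff L.topspace_psi switch_point)
  moreover have "val g om = 1" using g(2)[of om] by (simp add: L.topspace_psi)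
  then have "g \<noteq> 0" by auto
  ultimately have "one_complemented (invol.eigen 1) (cspace L.psi)"
    by (intro invol.one_complemented_eigen[of 1 g]) auto
  moreover have "unit_vec 0 \<noteq> 0" using norm_unit_vec[of 0] by auto
  then have "one_complemented X (cspace L.psi)"
    using unit_vec_in_X by (intro invol.one_complemented_eigen[of "-1"]) auto
  moreover have "\<not> is_C_space X"
    by (rule not_C_space_criterion[OF invol.subspace_eigen unit_vec_in_X sign_vec_in_X v(1) adversarial
          norm_unit_vec norm_sum_unit_vec norm_sum_sign_vec_tail dense_combinations])
  moreover have "X \<subseteq> cspace L.psi" using X_cspace by blast
  ultimately show ?thesis
    using K.compact_psi K.Hausdorff_psi K.separable_psi K.scattered_psi K.derivative3_psi
      L.compact_psi L.Hausdorff_psi L.separable_psi L.scattered_psi L.derivative3_psi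
      continuous_collapse collapse_surj invol.subspace_eigen invol.closed_eigen invol.banach_isomorphic_eigen_sum
    by (intro exI[of _ K.psi] exI[of _ L.psi] exI[of _ collapse] exI[of _ X]) (simp only: comp_collapse_eigen conj_assoc simp_thms)
qed

end
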